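(* There is an algorithm that, given an instance $(G,S,k)$ of FT-FVS-Ext where $G$ has $n$ vertices, runs in time $k^{O(k)} n^{O(1)}$ and either computes a 1-fvs $X$ of $G$ with $|X|\le k$ and $S\subseteq X$, or correctly concludes that no such set exists.
   Context: Graphs may have parallel edges but no self-loops. A set $X\subseteq V(G)$ is a 1-fault tolerant feedback vertex set (1-fvs) of $G$ if for every $v\in V(G)$ the graph $G-(X\setminus\{v\})$ is a forest; equivalently every cycle of $G$ (including length-2 cycles formed by parallel edges) contains at least two vertices of $X$. An instance of FT-FVS-Ext (Fault Tolerant FVS Extension) is a triple $(G,S,k)$ with $G$ a graph, $S\subseteq V(G)$, and $k$ an integer (the parameter). *)

theory Defs
  imports Main "HOL-Library.Multiset"
begin

section \<open>Multigraphs and fault tolerant feedback vertex sets\<close>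

text \<open>The edges form a multiset of two-element vertex sets, so parallel edges are repeated elements.\<close>

record 'a mgraph =
  verts :: "'a set"
  edges :: "'a set multiset"

definition multigraph :: "'a mgraph \<Rightarrow> bool" where
  "multigraph G \<longleftrightarrow> finite (verts G) \<and> (\<forall>e \<in># edges G. e \<subseteq> verts G \<and> card e = 2)"

definition delete_verts :: "'a mgraph \<Rightarrow> 'a set \<Rightarrow> 'a mgraph" where
  "delete_verts G Y =
     \<lparr>verts = verts G - Y, edges = filter_mset (\<lambda>e. e \<inter> Y = {}) (edges G)\<rparr>"

text \<open>
  The edges that a closed walk through the vertices \<open>vs\<close> (in this order) uses.  Comparing this
  multiset with the edges of the graph makes a cycle use distinct edges: a cycle of length two
  needs two parallel edges, since it requires \<open>{u, v}\<close> with multiplicity two.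
\<close>

definition cycle_edges :: "'a list \<Rightarrow> 'a set multiset" where
  "cycle_edges vs =
     mset (map (\<lambda>i. {vs ! i, vs ! (Suc i mod length vs)}) [0..<length vs])"

definition is_cycle :: "'a mgraph \<Rightarrow> 'a list \<Rightarrow> bool" where
  "is_cycle G vs \<longleftrightarrow> 2 \<le> length vs \<and> distinct vs \<and> set vs \<subseteq> verts G \<and>
     cycle_edges vs \<subseteq># edges G"

definition forest :: "'a mgraph \<Rightarrow> bool" where
  "forest G \<longleftrightarrow> (\<nexists>vs. is_cycle G vs)"

definition one_fvs :: "'a mgraph \<Rightarrow> 'a set \<Rightarrow> bool" where
  "one_fvs G X \<longleftrightarrow> X \<subseteq> verts G \<and> (\<forall>v \<in> verts G. forest (delete_verts G (X - {v})))"

lemma is_cycle_delete_verts: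
  "is_cycle (delete_verts G Y) vs \<longleftrightarrow> is_cycle G vs \<and> set vs \<inter> Y = {}"
proof -
  have mem: "e \<inter> Y = {}" if "set vs \<inter> Y = {}" "e \<in># cycle_edges vs" for e
  proof -
    from that(2) obtain i where i: "i < length vs" and e: "e = {vs ! i, vs ! (Suc i mod length vs)}"
      by (auto simp: cycle_edges_def)
    have "Suc i mod length vs < length vs" using i by (intro mod_less_divisor) linarith
    then have "e \<subseteq> set vs" using i e by auto
    then show ?thesis using that(1) by auto
  qed
  have "cycle_edges vs \<subseteq># filter_mset (\<lambda>e. e \<inter> Y = {}) (edges G) \<longleftrightarrow> cycle_edges vs \<subseteq># edges G"
    if "set vs \<inter> Y = {}"
  proof
    assume "cycle_edges vs \<subseteq># edges G"
    then have "filter_mset (\<lambda>e. e \<inter> Y = {}) (cycle_edges vs)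
        \<subseteq># filter_mset (\<lambda>e. e \<inter> Y = {}) (edges G)"
      by (rule multiset_filter_mono)
    moreover have "filter_mset (\<lambda>e. e \<inter> Y = {}) (cycle_edges vs) = cycle_edges vs"
      using mem[OF that] by (simp add: filter_mset_eq_conv)
    ultimately show "cycle_edges vs \<subseteq># filter_mset (\<lambda>e. e \<inter> Y = {}) (edges G)" by simp
  qed (meson multiset_filter_subset subset_mset.order_trans)
  then show ?thesis by (auto simp: is_cycle_def delete_verts_def)
qed

lemma one_fvs_iff_cycles:
  "one_fvs G X \<longleftrightarrow> X \<subseteq> verts G \<and> (\<forall>vs. is_cycle G vs \<longrightarrow> 2 \<le> card (X \<inter> set vs))"
proof -
  have "(\<forall>v \<in> verts G. set vs \<inter> (X - {v}) \<noteq> {}) \<longleftrightarrow> 2 \<le> card (X \<inter> set vs)"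
    if cyc: "is_cycle G vs" and X: "X \<subseteq> verts G" for vs
  proof
    assume L: "\<forall>v \<in> verts G. set vs \<inter> (X - {v}) \<noteq> {}"
    have "hd vs \<in> verts G" using cyc by (cases vs) (auto simp: is_cycle_def)
    with L obtain x where x: "x \<in> set vs" "x \<in> X" by blast
    with L X obtain y where y: "y \<in> set vs" "y \<in> X" "y \<noteq> x" by blast
    have "card {x, y} \<le> card (X \<inter> set vs)" using x y by (intro card_mono) auto
    then show "2 \<le> card (X \<inter> set vs)" using y(3) by simp
  next
    assume R: "2 \<le> card (X \<inter> set vs)"
    show "\<forall>v \<in> verts G. set vs \<inter> (X - {v}) \<noteq> {}"
    proof (intro ballI notI)
      fix v assume "set vs \<inter> (X - {v}) = {}"
      then have "X \<inter> set vs \<subseteq> {v}" by auto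
      then have "card (X \<inter> set vs) \<le> card {v}" by (intro card_mono) auto
      with R show False by simp
    qed
  qed
  then show ?thesis unfolding one_fvs_def forest_def is_cycle_delete_verts by blast
qed

definition ft_fvs_ext_solution :: "'a mgraph \<Rightarrow> 'a set \<Rightarrow> int \<Rightarrow> 'a set \<Rightarrow> bool" where
  "ft_fvs_ext_solution G S k X \<longleftrightarrow> one_fvs G X \<and> int (card X) \<le> k \<and> S \<subseteq> X"

section \<open>Model of computation\<close>

text \<open>
  Algorithms are closed programs of a first-order call-by-value language over binary trees with
  integer leaves.  A program is a finite list of function bodies that may call each other
  recursively; the first body is the entry point.  Variables are de Bruijn indices into the list of
  the arguments, extended at the front by \<open>Let\<close>.

  Every evaluation step costs one unit of time.  All operations take constant time on a random
  access machine with unit-cost addition: pairs are immutable, so they are shared and never copied,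
  and environments have a length bounded by the program.  There is no multiplication, so after
  \<open>t\<close> steps integers have at most \<open>O(t)\<close> more bits than those in the input, and the model is
  polynomially equivalent to Turing machines.  Evaluation of an ill-formed operation gets stuck.
\<close>

datatype data = Num int | Null | Pair data data

datatype exp =
    Var nat
  | Lit int
  | Empty
  | Cons_of exp exp
  | Head exp
  | Tail exp
  | Add exp exp
  | Sub exp exp
  | If_null exp exp exp
  | If_less exp exp exp exp
  | Let exp exp
  | Call nat "exp list"

type_synonym program = "exp list"

text \<open>\<open>eval P env e v t\<close>: expression \<open>e\<close> evaluates to \<open>v\<close> in time \<open>t\<close>.\<close>

inductive eval :: "program \<Rightarrow> data list \<Rightarrow> exp \<Rightarrow> data \<Rightarrow> nat \<Rightarrow> bool"
  and evals :: "program \<Rightarrow> data list \<Rightarrow> exp list \<Rightarrow> data list \<Rightarrow> nat \<Rightarrow> bool"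
  for P :: program
where
  eval_Var: "i < length env \<Longrightarrow> eval P env (Var i) (env ! i) 1"
| eval_Lit: "eval P env (Lit n) (Num n) 1"
| eval_Empty: "eval P env Empty Null 1"
| eval_Cons_of: "eval P env a v s \<Longrightarrow> eval P env b w t \<Longrightarrow>
    eval P env (Cons_of a b) (Pair v w) (s + t + 1)"
| eval_Head: "eval P env a (Pair v w) t \<Longrightarrow> eval P env (Head a) v (t + 1)"
| eval_Tail: "eval P env a (Pair v w) t \<Longrightarrow> eval P env (Tail a) w (t + 1)"
| eval_Add: "eval P env a (Num m) s \<Longrightarrow> eval P env b (Num n) t \<Longrightarrow>
    eval P env (Add a b) (Num (m + n)) (s + t + 1)"
| eval_Sub: "eval P env a (Num m) s \<Longrightarrow> eval P env b (Num n) t \<Longrightarrow>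
    eval P env (Sub a b) (Num (m - n)) (s + t + 1)"
| eval_If_null: "eval P env a v s \<Longrightarrow> eval P env (if v = Null then b else c) w t \<Longrightarrow>
    eval P env (If_null a b c) w (s + t + 1)"
| eval_If_less: "eval P env a (Num m) r \<Longrightarrow> eval P env b (Num n) s \<Longrightarrow>
    eval P env (if m < n then c else d) w t \<Longrightarrow>
    eval P env (If_less a b c d) w (r + s + t + 1)"
| eval_Let: "eval P env a v s \<Longrightarrow> eval P (v # env) b w t \<Longrightarrow>
    eval P env (Let a b) w (s + t + 1)"
| eval_Call: "f < length P \<Longrightarrow> evals P env as vs s \<Longrightarrow> eval P vs (P ! f) w t \<Longrightarrow>
    eval P env (Call f as) w (s + t + 1)"
| evals_Nil: "evals P env [] [] 0"
| evals_Cons: "eval P env a v s \<Longrightarrow> evals P env as vs t \<Longrightarrow>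
    evals P env (a # as) (v # vs) (s + t)"

inductive_cases eval_elims:
  "eval P env (Var i) v t" "eval P env (Lit n) v t" "eval P env Empty v t"
  "eval P env (Cons_of a b) v t" "eval P env (Head a) v t" "eval P env (Tail a) v t"
  "eval P env (Add a b) v t" "eval P env (Sub a b) v t"
  "eval P env (If_null a b c) v t" "eval P env (If_less a b c d) v t"
  "eval P env (Let a b) v t" "eval P env (Call f as) v t"

inductive_cases evals_elims:
  "evals P env [] vs t" "evals P env (a # as) vs t"

lemma eval_deterministic:
  "eval P env e v t \<Longrightarrow> (\<And>v' t'. eval P env e v' t' \<Longrightarrow> v' = v \<and> t' = t)"
  "evals P env es vs t \<Longrightarrow> (\<And>vs' t'. evals P env es vs' t' \<Longrightarrow> vs' = vs \<and> t' = t)"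
proof (induction rule: eval_evals.inducts)
  case eval_Var
  from eval_Var.prems show ?case by (rule eval_elims(1)) simp_all
next
  case eval_Lit
  from eval_Lit.prems show ?case by (rule eval_elims(2)) simp_all
next
  case eval_Empty
  from eval_Empty.prems show ?case by (rule eval_elims(3)) simp_all
next
  case eval_Cons_of
  from eval_Cons_of.prems show ?case by (rule eval_elims(4)) (auto dest!: eval_Cons_of.IH(2,4))
next
  case eval_Head
  from eval_Head.prems show ?case by (rule eval_elims(5)) (auto dest!: eval_Head.IH(2))
next
  case eval_Tail
  from eval_Tail.prems show ?case by (rule eval_elims(6)) (auto dest!: eval_Tail.IH(2))
next
  case eval_Add
  from eval_Add.prems show ?case by (rule eval_elims(7)) (auto dest!: eval_Add.IH(2,4))
next
  case eval_Sub
  from eval_Sub.prems show ?case by (rule eval_elims(8)) (auto dest!: eval_Sub.IH(2,4))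
next
  case eval_If_null
  from eval_If_null.prems show ?case by (rule eval_elims(9)) (auto dest!: eval_If_null.IH(2,4))
next
  case eval_If_less
  from eval_If_less.prems show ?case by (rule eval_elims(10)) (auto dest!: eval_If_less.IH(2,4,6))
next
  case eval_Let
  from eval_Let.prems show ?case by (rule eval_elims(11)) (auto dest!: eval_Let.IH(2,4))
next
  case eval_Call
  from eval_Call.prems show ?case by (rule eval_elims(12)) (auto dest!: eval_Call.IH(3,5))
next
  case evals_Nil
  from evals_Nil.prems show ?case by (rule evals_elims(1)) simp_all
next
  case evals_Cons
  from evals_Cons.prems show ?case by (rule evals_elims(2)) (auto dest!: evals_Cons.IH(2,4))
qed

definition runs :: "program \<Rightarrow> data list \<Rightarrow> data \<Rightarrow> nat \<Rightarrow> bool" where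
  "runs P args v t \<longleftrightarrow> P \<noteq> [] \<and> eval P args (P ! 0) v t"

section \<open>Encoding of instances and answers\<close>

fun encode_list :: "data list \<Rightarrow> data" where
  "encode_list [] = Null"
| "encode_list (x # xs) = Pair x (encode_list xs)"

definition encode_nats :: "nat list \<Rightarrow> data" where
  "encode_nats xs = encode_list (map (\<lambda>x. Num (int x)) xs)"

text \<open>
  A graph with vertices \<open>0, \<dots>, n - 1\<close> is given by its adjacency matrix, whose entries are the
  edge multiplicities.
\<close>

definition encode_graph :: "nat mgraph \<Rightarrow> data" where
  "encode_graph G = (let n = card (verts G) in
     encode_list (map (\<lambda>u. encode_nats (map (\<lambda>v. count (edges G) {u, v}) [0..<n])) [0..<n]))"

definition encode_instance :: "nat mgraph \<Rightarrow> nat set \<Rightarrow> int \<Rightarrow> data list" where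
  "encode_instance G S k = [encode_graph G, encode_nats (sorted_list_of_set S), Num k]"

fun encode_answer :: "nat list option \<Rightarrow> data" where
  "encode_answer None = Null"
| "encode_answer (Some xs) = Pair (encode_nats xs) Null"

text \<open>
  The time bound \<open>k\<^sup>O\<^sup>(\<^sup>k\<^sup>) n\<^sup>O\<^sup>(\<^sup>1\<^sup>)\<close> with one constant \<open>c\<close>
  for all the implicit ones.  The shifts only provide the constant factors that the
  O-notation leaves to the small values of \<open>k\<close> and \<open>n\<close> (for which \<open>k ^ (c * k) * n ^ c\<close> would be
  0 or 1 whatever \<open>c\<close> is); a negative \<open>k\<close> is treated like \<open>0\<close>.
\<close>

definition fpt_time_bound :: "nat \<Rightarrow> int \<Rightarrow> nat \<Rightarrow> nat" where
  "fpt_time_bound c k n = c * (nat k + 2) ^ (c * nat k) * (n + 1) ^ c"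

end

theory Submission
  imports Defs
begin

text \<open>
  A vertex set is a core if it induces a subgraph of minimum degree at least two.  Every cycle is a
  core and every nonempty core contains a cycle, so \<open>X\<close> is a 1-fvs iff it meets every nonempty core
  at least twice.  Given \<open>S\<close>, only the cores with at most one vertex in \<open>S\<close> matter; let \<open>K\<close> be the
  union of these, minus \<open>S\<close>, and \<open>A = K \<union> S\<close>.

  Let \<open>X \<supseteq> S\<close> be a solution with \<open>|X| \<le> k\<close>.  The graph on \<open>K - X\<close> is a forest, and each vertex of
  \<open>X\<close> sends at most one edge to each of its trees.  Hence every tree sends at most \<open>k\<close> edges to \<open>X\<close>,
  and as all degrees in \<open>A\<close> are at least two, every vertex outside \<open>X\<close> has degree at most \<open>k\<close>: a vertex
  of larger degree is forced into the solution.  Otherwise, every tree is adjacent to one of the at most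
  \<open>k\<close> vertices of \<open>X - S\<close> in \<open>A\<close>, so there are at most \<open>k\<^sup>2\<close> trees, and counting degrees leaves
  \<open>O(k\<^sup>3)\<close> branching vertices and \<open>O(k\<^sup>3)\<close> chains of vertices of degree two.  The vertices of a chain
  lie in the same cores.

  If all cores in \<open>A\<close> through \<open>y\<close> contain \<open>u\<close>, then \<open>y\<close> can be exchanged for \<open>u\<close> in a solution.  It
  therefore suffices to branch over \<open>O(k\<^sup>3)\<close> vertices that dominate all others in this sense, to depth
  at most \<open>k\<close>.  Domination and \<open>K\<close> are computed by repeatedly deleting vertices of degree at most one.
\<close>

section \<open>Cores and trees\<close>

locale weighted_graph =
  fixes a :: "'a \<Rightarrow> 'a \<Rightarrow> nat"
  assumes sym: "a u v = a v u" and irrefl: "a v v = 0"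
begin

definition deg :: "'a \<Rightarrow> 'a set \<Rightarrow> nat" where
  "deg v A = (\<Sum>u\<in>A. a v u)"

text \<open>Twice the number of edges inside \<open>A\<close>, counted with multiplicity.\<close>

definition vol :: "'a set \<Rightarrow> nat" where
  "vol A = (\<Sum>v\<in>A. deg v A)"

definition core :: "'a set \<Rightarrow> bool" where
  "core W \<longleftrightarrow> (\<forall>w\<in>W. 2 \<le> deg w W)"

definition acyclic :: "'a set \<Rightarrow> bool" where
  "acyclic A \<longleftrightarrow> (\<forall>W\<subseteq>A. core W \<longrightarrow> W = {})"

text \<open>By \<open>acyclic_vol\<close> a nonempty finite acyclic set satisfies the reverse
  inequality, so this asks for exactly \<open>card T - 1\<close> edges. For a forest that is
  connectedness, expressed without paths.\<close>

definition tree :: "'a set \<Rightarrow> bool" where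
  "tree T \<longleftrightarrow> T \<noteq> {} \<and> finite T \<and> acyclic T \<and> 2 * card T \<le> vol T + 2"

definition hits_twice :: "'a set \<Rightarrow> 'a set \<Rightarrow> bool" where
  "hits_twice V X \<longleftrightarrow> (\<forall>W\<subseteq>V. core W \<longrightarrow> W \<noteq> {} \<longrightarrow> 2 \<le> card (W \<inter> X))"

lemma deg_mono: "finite B \<Longrightarrow> A \<subseteq> B \<Longrightarrow> deg v A \<le> deg v B"
  by (simp add: deg_def sum_mono2)

lemma deg_Un: "finite A \<Longrightarrow> finite B \<Longrightarrow> A \<inter> B = {} \<Longrightarrow> deg v (A \<union> B) = deg v A + deg v B"
  by (simp add: deg_def sum.union_disjoint)

lemma deg_insert: "finite A \<Longrightarrow> u \<notin> A \<Longrightarrow> deg v (insert u A) = a v u + deg v A"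
  by (simp add: deg_def)

lemma deg_pos_iff: "finite A \<Longrightarrow> 0 < deg v A \<longleftrightarrow> (\<exists>u\<in>A. 0 < a v u)"
  by (simp add: deg_def sum_eq_0_iff flip: neq0_conv)

lemma adj_le_deg: "finite A \<Longrightarrow> u \<in> A \<Longrightarrow> a v u \<le> deg v A"
  by (simp add: deg_def member_le_sum)

lemma sum_deg_swap: "(\<Sum>v\<in>A. deg v B) = (\<Sum>u\<in>B. deg u A)"
proof -
  have "(\<Sum>v\<in>A. deg v B) = (\<Sum>u\<in>B. \<Sum>v\<in>A. a v u)"
    unfolding deg_def by (rule sum.swap)
  also have "\<dots> = (\<Sum>u\<in>B. deg u A)"
    unfolding deg_def by (intro sum.cong refl sym)
  finally show ?thesis .
qed

lemma vol_Un:
  assumes "finite A" "finite B" "A \<inter> B = {}"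
  shows "vol (A \<union> B) = vol A + vol B + 2 * (\<Sum>v\<in>A. deg v B)"
proof -
  have "vol (A \<union> B) = (\<Sum>v\<in>A. deg v A + deg v B) + (\<Sum>v\<in>B. deg v A + deg v B)"
    using assms by (simp add: vol_def sum.union_disjoint deg_Un)
  then show ?thesis
    by (simp add: sum.distrib sum_deg_swap[of B A] vol_def)
qed

lemma vol_insert:
  assumes "finite A" "v \<notin> A"
  shows "vol (insert v A) = vol A + 2 * deg v A"
proof -
  have "vol {v} = 0"
    by (simp add: vol_def deg_def irrefl)
  then show ?thesis
    using vol_Un[of "{v}" A] assms by simp
qed

lemma coreD: "core W \<Longrightarrow> w \<in> W \<Longrightarrow> 2 \<le> deg w W"
  by (simp add: core_def)

lemma acyclic_subset: "acyclic A \<Longrightarrow> B \<subseteq> A \<Longrightarrow> acyclic B"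
  by (auto simp: acyclic_def)

text \<open>A nonempty acyclic set is not a core, so it has a vertex of degree at most one. Deleting
  it and inducting gives the usual bound \<open>card A - 1\<close> on the number of edges of a
  forest.\<close>

lemma acyclic_vol:
  assumes "finite A" "acyclic A" "A \<noteq> {}"
  shows "vol A + 2 \<le> 2 * card A"
  using assms
proof (induction "card A" arbitrary: A rule: less_induct)
  case less
  then have "\<not> core A" by (auto simp: acyclic_def)
  then obtain v where v: "v \<in> A" "deg v A \<le> 1" by (auto simp: core_def not_le)
  let ?B = "A - {v}"
  have "deg v ?B \<le> 1"
    using v deg_mono[of A ?B v] less.prems by fastforce
  moreover have "vol A = vol ?B + 2 * deg v ?B"
    using vol_insert[of ?B v] less.prems v by (simp add: insert_absorb)
  moreover have "vol ?B + 2 \<le> 2 * card ?B" if "?B \<noteq> {}"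
    using less.hyps[OF card_Diff1_less] less.prems v that acyclic_subset[of A ?B] by auto
  moreover have "card A = Suc (card ?B)"
    using card.remove[OF less.prems(1) v(1)] .
  \<comment> \<open>The claim fails for the empty set, so deleting the last vertex is treated
    separately.\<close>
  moreover have "deg v ?B = 0" "vol ?B = 0" if "?B = {}"
    unfolding that by (simp_all add: vol_def deg_def)
  ultimately show ?case
    by (cases "?B = {}") linarith+
qed

lemma acyclic_vol_le:
  assumes "finite A" "acyclic A"
  shows "vol A \<le> 2 * card A"
  using acyclic_vol[OF assms] by (cases "A = {}") (auto simp: vol_def)

lemma tree_singleton: "tree {v}"
proof -
  have "W = {}" if "W \<subseteq> {v}" "core W" for W
  proof (rule ccontr)
    assume "W \<noteq> {}"
    with that(1) have "W = {v}" by blast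
    with that(2) show False by (simp add: core_def deg_def irrefl)
  qed
  then show ?thesis
    by (auto simp: tree_def acyclic_def)
qed

text \<open>If no edge left \<open>U\<close>, the forests on \<open>U\<close> and
  \<open>T - U\<close> would together have at most \<open>card T - 2\<close> edges, one fewer than
  \<open>tree T\<close> demands.\<close>

lemma tree_connected:
  assumes "tree T" "U \<subseteq> T" "U \<noteq> {}" "U \<noteq> T"
  shows "\<exists>u\<in>U. \<exists>w\<in>T - U. 0 < a u w"
proof (rule ccontr)
  assume "\<not> ?thesis"
  then have "(\<Sum>u\<in>U. deg u (T - U)) = 0"
    by (simp add: deg_def)
  moreover have fin: "finite U" "finite T"
    using assms finite_subset by (auto simp: tree_def)
  ultimately have "vol T = vol U + vol (T - U)"
    using vol_Un[of U "T - U"] assms(2) by (simp add: Un_absorb1)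
  moreover have "acyclic U" "acyclic (T - U)"
    using assms(1,2) acyclic_subset[of T] by (auto simp: tree_def)
  then have "vol U + 2 \<le> 2 * card U" "vol (T - U) + 2 \<le> 2 * card (T - U)"
    using acyclic_vol[of U] acyclic_vol[of "T - U"] assms(2-4) fin by blast+
  moreover have "card T = card U + card (T - U)"
    using fin assms(2) by (metis card_Un_disjoint Diff_disjoint Un_Diff_cancel Un_absorb1 finite_Diff)
  ultimately show False
    using assms(1) by (simp add: tree_def)
qed

text \<open>\<open>T\<close> is the component of \<open>v\<close>, found as an inclusion-maximal
  tree. A vertex of \<open>F - T\<close> with a neighbour in \<open>T\<close> could be added, since
  it brings the edge that \<open>tree\<close> requires for one more vertex.\<close>

lemma maximal_tree:
  assumes "finite F" "acyclic F" "v \<in> F"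
  obtains T where "tree T" "v \<in> T" "T \<subseteq> F" "\<And>t u. t \<in> T \<Longrightarrow> u \<in> F - T \<Longrightarrow> a t u = 0"
proof -
  let ?C = "{T. tree T \<and> v \<in> T \<and> T \<subseteq> F}"
  have "finite ?C" "{v} \<in> ?C"
    using assms tree_singleton by (auto intro: finite_subset[of _ "Pow F"])
  then obtain T where T: "T \<in> ?C" and max: "\<And>T'. T' \<in> ?C \<Longrightarrow> T \<subseteq> T' \<Longrightarrow> T' = T"
    by (metis (no_types, lifting) finite_has_maximal2)
  have "a t u = 0" if "t \<in> T" "u \<in> F - T" for t u
  proof (rule ccontr)
    assume "a t u \<noteq> 0"
    have fin: "finite T" using T by (simp add: tree_def)
    have "1 \<le> deg u T"
      using adj_le_deg[OF fin that(1), of u] \<open>a t u \<noteq> 0\<close> by (simp add: sym[of u t])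
    then have "tree (insert u T)"
      using T that fin acyclic_subset[OF assms(2), of "insert u T"]
      by (auto simp: tree_def vol_insert)
    then have "insert u T = T"
      using T that by (intro max) auto
    then show False using that by blast
  qed
  then show ?thesis using T that by blast
qed

lemma tree_attach:
  assumes "tree T" "x \<notin> T" "acyclic (insert x T)"
  shows "deg x T \<le> 1"
  using acyclic_vol[OF _ assms(3)] assms by (auto simp: tree_def vol_insert)

text \<open>A core through \<open>v\<close> needs degree two at \<open>v\<close>, hence all the
  edges that \<open>v\<close> has in \<open>A\<close>, together with their other ends.\<close>

lemma degree_two_neighbour_in_core:
  assumes "core W" "W \<subseteq> A" "finite A" "v \<in> W" "deg v A = 2" "u \<in> A" "0 < a v u"
  shows "u \<in> W"
proof (rule ccontr)
  assume "u \<notin> W"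
  then have "deg v W \<le> deg v (A - {u})"
    using assms by (intro deg_mono) auto
  also have "\<dots> < deg v A"
    using deg_insert[of "A - {u}" u v] assms by (simp add: insert_absorb)
  finally show False using coreD[OF assms(1,4)] assms(5) by simp
qed

text \<open>Membership in \<open>W\<close> spreads along the edges of \<open>P\<close>: each vertex
  of \<open>P\<close> in \<open>W\<close> brings in all its neighbours in \<open>A\<close>, and
  \<open>P\<close> is connected.\<close>

lemma core_contains_chain:
  assumes "tree P" "P \<subseteq> A" "finite A" "\<And>p. p \<in> P \<Longrightarrow> deg p A = 2"
    and "core W" "W \<subseteq> A" "v \<in> P" "v \<in> W" "z \<in> P"
  shows "z \<in> W"
proof (rule ccontr)
  assume "z \<notin> W"
  then obtain u w where "u \<in> P \<inter> W" "w \<in> P - P \<inter> W" "0 < a u w"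
    using tree_connected[OF assms(1), of "P \<inter> W"] assms(7-9) by blast
  then show False
    using degree_two_neighbour_in_core[OF assms(5,6,3), of u w] assms(2,4) by blast
qed

end

section \<open>Extending a partial solution \<open>S\<close>\<close>

locale extension_node = weighted_graph a for a :: "'a \<Rightarrow> 'a \<Rightarrow> nat" +
  fixes V S :: "'a set"
  assumes finite_V: "finite V" and S_sub: "S \<subseteq> V"
begin

definition K :: "'a set" where
  "K = \<Union>{W. W \<subseteq> V \<and> core W \<and> card (W \<inter> S) \<le> 1} - S"

definition A :: "'a set" where
  "A = K \<union> S"

lemma A_sub: "A \<subseteq> V" and K_sub: "K \<subseteq> V" and K_S: "K \<inter> S = {}"
  using S_sub by (auto simp: A_def K_def)

lemma finites: "finite A" "finite K" "finite S"
  using finite_subset[OF A_sub finite_V] finite_subset[OF K_sub finite_V]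
    finite_subset[OF S_sub finite_V] .

lemma relevant_core_sub: "W \<subseteq> V \<Longrightarrow> core W \<Longrightarrow> card (W \<inter> S) \<le> 1 \<Longrightarrow> W \<subseteq> A"
  by (auto simp: A_def K_def)

lemma K_obtain:
  assumes "v \<in> K"
  obtains W where "v \<in> W" "W \<subseteq> A" "core W" "card (W \<inter> S) \<le> 1" "W \<subseteq> V"
proof -
  from assms obtain W where "v \<in> W" "W \<subseteq> V" "core W" "card (W \<inter> S) \<le> 1"
    by (auto simp: K_def)
  then show ?thesis using that relevant_core_sub[of W] by simp
qed

lemma deg_K_ge2:
  assumes "v \<in> K"
  shows "2 \<le> deg v A"
proof -
  obtain W where "v \<in> W" "W \<subseteq> A" "core W" using assms by (rule K_obtain)
  then show ?thesis
    using coreD[of W v] deg_mono[OF finites(1), of W v] by linarith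
qed

text \<open>A core that \<open>S\<close> meets at most once lies in \<open>A\<close>. If
  \<open>K\<close> is empty and the core is not, it lies in \<open>S\<close> and is a single vertex,
  which has degree zero because there are no loops.\<close>

lemma hits_twice_iff_K_empty: "hits_twice V S \<longleftrightarrow> K = {}"
proof
  assume "hits_twice V S"
  show "K = {}"
  proof (rule ccontr)
    assume "K \<noteq> {}"
    then obtain v where "v \<in> K" by blast
    then obtain W where "v \<in> W" "core W" "card (W \<inter> S) \<le> 1" "W \<subseteq> V"
      by (rule K_obtain)
    moreover from this \<open>hits_twice V S\<close> have "2 \<le> card (W \<inter> S)"
      unfolding hits_twice_def by blast
    ultimately show False by simp
  qed
next
  assume K: "K = {}"
  show "hits_twice V S"
    unfolding hits_twice_def
  proof (intro allI impI, rule ccontr)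
    fix W assume W: "W \<subseteq> V" "core W" "W \<noteq> {}" "\<not> 2 \<le> card (W \<inter> S)"
    with relevant_core_sub[of W] K have "W \<subseteq> S" by (auto simp: A_def)
    then have "card W \<le> 1" using W(4) by (simp add: Int_absorb2)
    moreover have "finite W" using finite_subset[OF W(1) finite_V] .
    ultimately obtain w where "W = {w}"
      using W(3) by (metis One_nat_def card_0_eq card_1_singletonE le_SucE le_zero_eq)
    then show False using W(2) by (simp add: core_def deg_def irrefl)
  qed
qed

text \<open>A core met fewer than twice by a set containing \<open>S\<close> lies inside
  \<open>A\<close>. Such a core does not lose in the exchange, since it contains \<open>u\<close>
  whenever it contains \<open>y\<close>.\<close>

lemma exchange:
  assumes X: "hits_twice V X" "S \<subseteq> X" "X \<subseteq> V" and y: "y \<in> X - S" and u: "u \<in> V - X"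
    and dom: "\<And>W. core W \<Longrightarrow> W \<subseteq> A \<Longrightarrow> y \<in> W \<Longrightarrow> u \<in> W"
  shows "hits_twice V (insert u (X - {y}))"
  unfolding hits_twice_def
proof (intro allI impI, rule ccontr)
  let ?X = "insert u (X - {y})"
  fix W assume W: "W \<subseteq> V" "core W" "W \<noteq> {}" "\<not> 2 \<le> card (W \<inter> ?X)"
  have fin: "finite W" using finite_subset[OF W(1) finite_V] .
  have "W \<inter> S \<subseteq> W \<inter> ?X" using X(2) y by blast
  then have "card (W \<inter> S) \<le> card (W \<inter> ?X)" using fin by (simp add: card_mono)
  then have WA: "W \<subseteq> A" using W relevant_core_sub by simp
  have "2 \<le> card (W \<inter> X)" using X(1) W(1-3) by (simp add: hits_twice_def)
  moreover have "card (W \<inter> X) \<le> card (W \<inter> ?X)"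
  proof (cases "y \<in> W")
    case True
    then have "u \<in> W" using dom W(2) WA by blast
    then have "W \<inter> ?X = insert u (W \<inter> X - {y})" by auto
    moreover have "card (insert u (W \<inter> X - {y})) = Suc (card (W \<inter> X - {y}))"
      using fin u by simp
    moreover have "card (W \<inter> X) = Suc (card (W \<inter> X - {y}))"
      using True y fin by (intro card.remove) auto
    ultimately show ?thesis by simp
  next
    case False
    then show ?thesis using fin by (intro card_mono) auto
  qed
  ultimately show False using W(4) by linarith
qed

text \<open>A vertex outside \<open>A\<close> lies on none of the cores that \<open>S\<close> meets
  at most once, so giving it up harms none of them.\<close>

lemma minimal_sub_K:
  assumes X: "hits_twice V X" "S \<subseteq> X" "X \<subseteq> V" and y: "y \<in> X - S" "y \<notin> K"
  shows "hits_twice V (X - {y})"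
  unfolding hits_twice_def
proof (intro allI impI, rule ccontr)
  fix W assume W: "W \<subseteq> V" "core W" "W \<noteq> {}" "\<not> 2 \<le> card (W \<inter> (X - {y}))"
  have fin: "finite W" using finite_subset[OF W(1) finite_V] .
  have "W \<inter> S \<subseteq> W \<inter> (X - {y})" using X(2) y by blast
  then have "card (W \<inter> S) \<le> card (W \<inter> (X - {y}))" using fin by (simp add: card_mono)
  then have "W \<subseteq> A" using W relevant_core_sub by simp
  then have "W \<inter> (X - {y}) = W \<inter> X" using y by (auto simp: A_def)
  then show False using X(1) W by (simp add: hits_twice_def)
qed

text \<open>A smallest solution \<open>Y\<close> contains some \<open>y\<close> outside
  \<open>S\<close>, because \<open>S\<close> alone does not suffice for nonempty \<open>K\<close>.
  Minimality puts \<open>y\<close> into \<open>K\<close>. Its dominating candidate is in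
  \<open>Y\<close> already or can replace \<open>y\<close> without changing the size.\<close>

lemma extension_by_candidate:
  assumes X: "hits_twice V X" "S \<subseteq> X" "X \<subseteq> V" "card X \<le> k" and K: "K \<noteq> {}"
    and C: "C \<subseteq> K" "\<And>y. y \<in> K \<Longrightarrow> \<exists>u\<in>C. \<forall>W. core W \<longrightarrow> W \<subseteq> A \<longrightarrow> y \<in> W \<longrightarrow> u \<in> W"
  shows "\<exists>u\<in>C. \<exists>X'. hits_twice V X' \<and> insert u S \<subseteq> X' \<and> X' \<subseteq> V \<and> card X' \<le> k"
proof -
  define Q where "Q X \<longleftrightarrow> hits_twice V X \<and> S \<subseteq> X \<and> X \<subseteq> V \<and> card X \<le> k" for X
  have "Q X" using X by (simp add: Q_def)
  then obtain Y where Y: "Q Y" and min: "\<And>Z. Q Z \<Longrightarrow> card Y \<le> card Z"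
    using ex_has_least_nat[of Q X card] by blast
  have finY: "finite Y" using Y finite_V finite_subset by (auto simp: Q_def)
  have "Y \<noteq> S" using Y hits_twice_iff_K_empty K by (auto simp: Q_def)
  then obtain y where y: "y \<in> Y - S" using Y by (auto simp: Q_def)
  have "y \<in> K"
  proof (rule ccontr)
    assume "y \<notin> K"
    then have "Q (Y - {y})"
      using minimal_sub_K[of Y y] Y y card_Diff1_le[of Y y] by (auto simp: Q_def)
    then show False using min[of "Y - {y}"] y finY card_Diff1_less[of Y y] by auto
  qed
  then obtain u where u: "u \<in> C" "\<And>W. core W \<Longrightarrow> W \<subseteq> A \<Longrightarrow> y \<in> W \<Longrightarrow> u \<in> W"
    using C(2) by blast
  show ?thesis
  proof (cases "u \<in> Y")
    case True
    then show ?thesis using u(1) Y by (auto simp: Q_def)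
  next
    case False
    have uV: "u \<in> V - Y" using False u(1) C(1) K_sub by blast
    have "hits_twice V (insert u (Y - {y}))"
      using Y by (intro exchange[OF _ _ _ y uV u(2)]) (auto simp: Q_def)
    moreover have "card (insert u (Y - {y})) = card Y"
      using card.remove[of Y y] y False finY by simp
    ultimately show ?thesis
      using u(1) Y y uV by (intro bexI[of _ u] exI[of _ "insert u (Y - {y})"]) (auto simp: Q_def)
  qed
qed

end

section \<open>Bounds on degrees and candidates when a solution exists\<close>

locale solved_node = extension_node a V S for a :: "'a \<Rightarrow> 'a \<Rightarrow> nat" and V S +
  fixes X :: "'a set" and k :: nat
  assumes sol: "hits_twice V X" and S_X: "S \<subseteq> X" and X_V: "X \<subseteq> V" and card_X: "card X \<le> k"
begin

definition F :: "'a set" where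
  "F = K - X"

definition Y :: "'a set" where
  "Y = K \<inter> X"

lemma finite_F: "finite F" and finite_Y: "finite Y" and finite_X: "finite X"
  using finites finite_subset[OF X_V finite_V] by (simp_all add: F_def Y_def)

lemma A_split: "A = F \<union> (Y \<union> S)" "F \<inter> (Y \<union> S) = {}" "Y \<inter> S = {}" "Y \<union> S \<subseteq> X"
  using S_X K_S by (auto simp: F_def Y_def A_def)

lemma F_sub: "F \<subseteq> V"
  using K_sub by (auto simp: F_def)

lemma card_Y_le: "card Y \<le> k" and card_S_le: "card S \<le> k"
  using card_mono[OF finite_X, of Y] card_mono[OF finite_X, of S] A_split(4) card_X by auto

lemma acyclic_insert:
  assumes "T \<subseteq> F" "x \<in> X"
  shows "acyclic (insert x T)"
  unfolding acyclic_def
proof (intro allI impI, rule ccontr)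
  fix W assume W: "W \<subseteq> insert x T" "core W" "W \<noteq> {}"
  then have "W \<subseteq> V" using assms X_V F_sub by blast
  then have "2 \<le> card (W \<inter> X)" using W sol by (simp add: hits_twice_def)
  moreover have "W \<inter> X \<subseteq> {x}" using W(1) assms(1) by (auto simp: F_def)
  then have "card (W \<inter> X) \<le> card {x}" by (intro card_mono) auto
  ultimately show False by simp
qed

lemma acyclic_F: "acyclic F"
  unfolding acyclic_def
proof (intro allI impI, rule ccontr)
  fix W assume W: "W \<subseteq> F" "core W" "W \<noteq> {}"
  then have "2 \<le> card (W \<inter> X)" using F_sub sol by (auto simp: hits_twice_def)
  moreover have "W \<inter> X = {}" using W(1) by (auto simp: F_def)
  ultimately show False by simp
qed

lemma deg_tree_le1:
  assumes "tree T" "T \<subseteq> F" "x \<in> X"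
  shows "deg x T \<le> 1"
  using assms by (intro tree_attach acyclic_insert) (auto simp: F_def)

text \<open>Let \<open>T\<close> be the component of \<open>v\<close> in \<open>F\<close>. Each
  vertex of \<open>Y \<union> S\<close> sends at most one edge into \<open>T\<close>, so the degrees
  over \<open>T\<close> sum to at most \<open>2 * card T - 2 + k\<close>. The other vertices of
  \<open>T\<close> use up at least two each, which leaves at most \<open>k\<close> for
  \<open>v\<close>.\<close>

lemma deg_le:
  assumes "v \<in> F"
  shows "deg v A \<le> k"
proof -
  obtain T where T: "tree T" "v \<in> T" "T \<subseteq> F" "\<And>t u. t \<in> T \<Longrightarrow> u \<in> F - T \<Longrightarrow> a t u = 0"
    using maximal_tree[OF finite_F acyclic_F assms] by metis
  have fin: "finite T" using T(1) by (simp add: tree_def)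
  have deg: "deg t A = deg t T + deg t (Y \<union> S)" if "t \<in> T" for t
  proof -
    have "deg t (F - T) = 0" using T(4)[OF that] by (simp add: deg_def)
    then have "deg t F = deg t T"
      using deg_Un[of T "F - T" t] T(3) fin finite_F by (simp add: Un_absorb1)
    then show ?thesis
      using deg_Un[of F "Y \<union> S" t] finite_F finite_Y finites A_split by simp
  qed
  have "(\<Sum>t\<in>T. deg t (Y \<union> S)) = (\<Sum>x\<in>Y \<union> S. deg x T)" by (rule sum_deg_swap)
  also have "\<dots> \<le> (\<Sum>x\<in>Y \<union> S. 1)"
    using deg_tree_le1[OF T(1,3)] A_split(4) by (intro sum_mono) auto
  also have "\<dots> \<le> k"
    using card_mono[OF finite_X A_split(4)] card_X by simp
  finally have "(\<Sum>t\<in>T. deg t A) \<le> vol T + k"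
    by (simp add: deg sum.distrib vol_def)
  also have "\<dots> + 2 \<le> 2 * card T + k"
    using acyclic_vol[of T] T(1) by (simp add: tree_def)
  finally have "(\<Sum>t\<in>T. deg t A) + 2 \<le> 2 * card T + k" by simp
  moreover have "(\<Sum>t\<in>T. deg t A) = deg v A + (\<Sum>t\<in>T - {v}. deg t A)"
    by (rule sum.remove[OF fin T(2)])
  moreover have "(\<Sum>t\<in>T - {v}. 2) \<le> (\<Sum>t\<in>T - {v}. deg t A)"
    using T(3) deg_K_ge2 by (intro sum_mono) (auto simp: F_def)
  moreover have "card T = Suc (card (T - {v}))"
    by (rule card.remove[OF fin T(2)])
  ultimately show ?thesis by simp
qed

text \<open>Take a core \<open>W\<close> through \<open>T\<close> with at most one vertex in
  \<open>S\<close>. Without neighbours in \<open>Y\<close>, the vertices of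
  \<open>W \<inter> T\<close> get their degrees in \<open>W\<close> from the forest on
  \<open>W \<inter> T\<close> and at most one edge to \<open>S\<close>, which is too little for
  degree two everywhere.\<close>

lemma tree_meets_Y:
  assumes T: "tree T" "T \<subseteq> F" "\<And>t u. t \<in> T \<Longrightarrow> u \<in> F - T \<Longrightarrow> a t u = 0"
  shows "\<exists>z\<in>T. \<exists>y\<in>Y. 0 < a z y"
proof (rule ccontr)
  assume "\<not> ?thesis"
  then have noY: "a z y = 0" if "z \<in> T" "y \<in> Y" for z y using that by auto
  obtain w where "w \<in> T" using T(1) by (auto simp: tree_def)
  with T(2) obtain W where W: "w \<in> W" "W \<subseteq> A" "core W" "card (W \<inter> S) \<le> 1"
    by (metis DiffD1 F_def K_obtain subset_iff)
  let ?U = "W \<inter> T"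
  have fin: "finite W" "finite T" using W(2) finites finite_subset T(1) by (auto simp: tree_def)
  have U: "?U \<noteq> {}" "finite ?U" "acyclic ?U"
    using W(1) \<open>w \<in> T\<close> fin acyclic_subset[OF acyclic_F, of ?U] T(2) by auto
  have "deg t W = deg t ?U + deg t (W \<inter> S)" if "t \<in> ?U" for t
  proof -
    have "a t u = 0" if "u \<in> W - (?U \<union> W \<inter> S)" for u
    proof -
      have "u \<in> F - T \<or> u \<in> Y" using that W(2) unfolding A_split(1) by blast
      then show ?thesis using T(3) noY \<open>t \<in> ?U\<close> by blast
    qed
    then have "deg t (W - (?U \<union> W \<inter> S)) = 0" by (simp add: deg_def)
    moreover have "deg t W = deg t (?U \<union> W \<inter> S) + deg t (W - (?U \<union> W \<inter> S))"
      using deg_Un[of "?U \<union> W \<inter> S" "W - (?U \<union> W \<inter> S)" t] fin by (simp add: Un_absorb1)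
    moreover have "deg t (?U \<union> W \<inter> S) = deg t ?U + deg t (W \<inter> S)"
      using fin T(2) A_split(2) by (intro deg_Un) auto
    ultimately show ?thesis by simp
  qed
  then have "(\<Sum>t\<in>?U. deg t W) = vol ?U + (\<Sum>t\<in>?U. deg t (W \<inter> S))"
    by (simp add: sum.distrib vol_def)
  moreover have "(\<Sum>t\<in>?U. 2) \<le> (\<Sum>t\<in>?U. deg t W)"
    using W(3) by (intro sum_mono) (auto dest: coreD)
  moreover have "(\<Sum>t\<in>?U. deg t (W \<inter> S)) = (\<Sum>s\<in>W \<inter> S. deg s ?U)" by (rule sum_deg_swap)
  moreover have "(\<Sum>s\<in>W \<inter> S. deg s ?U) \<le> (\<Sum>s\<in>W \<inter> S. 1)"
  proof (intro sum_mono)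
    fix s assume "s \<in> W \<inter> S"
    then have "deg s T \<le> 1" using deg_tree_le1[OF T(1,2)] S_X by auto
    then show "deg s ?U \<le> 1" using deg_mono[OF fin(2), of ?U s] by simp
  qed
  moreover have "vol ?U + 2 \<le> 2 * card ?U" using U by (intro acyclic_vol)
  ultimately show False using W(4) by simp
qed

definition Z\<^sub>0 :: "'a set" where
  "Z\<^sub>0 = {z \<in> F. \<exists>y\<in>Y. 0 < a z y}"

text \<open>Each component of \<open>F\<close> contains a vertex of \<open>Z\<^sub>0\<close> by
  \<open>tree_meets_Y\<close> and receives at most one edge from \<open>s\<close>. Hence choosing
  such a vertex in the components of the neighbours of \<open>s\<close> is injective.\<close>

lemma deg_S_le:
  assumes "s \<in> S"
  shows "deg s F \<le> card Z\<^sub>0"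
proof -
  have "\<exists>T. tree T \<and> w \<in> T \<and> T \<subseteq> F \<and> (\<forall>t\<in>T. \<forall>u\<in>F - T. a t u = 0)" if "w \<in> F" for w
    using maximal_tree[OF finite_F acyclic_F that] by metis
  then obtain T where T: "\<And>w. w \<in> F \<Longrightarrow> tree (T w)" "\<And>w. w \<in> F \<Longrightarrow> w \<in> T w"
    "\<And>w. w \<in> F \<Longrightarrow> T w \<subseteq> F" "\<And>w t u. w \<in> F \<Longrightarrow> t \<in> T w \<Longrightarrow> u \<in> F - T w \<Longrightarrow> a t u = 0"
    by metis
  have "\<exists>z\<in>T w. z \<in> Z\<^sub>0" if "w \<in> F" for w
    using tree_meets_Y[OF T(1) T(3) T(4)] T(3) that by (fastforce simp: Z\<^sub>0_def)
  then obtain z where z: "\<And>w. w \<in> F \<Longrightarrow> z w \<in> T w" "\<And>w. w \<in> F \<Longrightarrow> z w \<in> Z\<^sub>0"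
    by metis
  let ?N = "{w \<in> F. 0 < a s w}"
  have s1: "deg s (T w) \<le> 1" if "w \<in> F" for w
    using T that assms S_X by (intro deg_tree_le1) auto
  have finT: "finite (T w)" if "w \<in> F" for w using T(1)[OF that] by (simp add: tree_def)
  have "deg s F = deg s ?N"
    unfolding deg_def by (rule sum.mono_neutral_right) (auto simp: finite_F)
  also have "\<dots> \<le> (\<Sum>w\<in>?N. 1)"
    unfolding deg_def
  proof (intro sum_mono)
    fix w assume "w \<in> ?N"
    then show "a s w \<le> 1" using s1[of w] adj_le_deg[OF finT T(2), of w s] by auto
  qed
  also have "\<dots> \<le> card Z\<^sub>0"
  proof -
    have "inj_on z ?N"
    proof (rule inj_onI, rule ccontr)
      fix w w' assume w: "w \<in> ?N" "w' \<in> ?N" "z w = z w'" "w \<noteq> w'"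
      have "w' \<in> T w"
      proof (rule ccontr)
        assume "w' \<notin> T w"
        \<comment> \<open>\<open>T w'\<close> is connected and meets \<open>T w\<close> in the
          shared representative, so an edge of it would leave the component
          \<open>T w\<close>.\<close>
        then obtain u u' where "u \<in> T w' \<inter> T w" "u' \<in> T w' - T w' \<inter> T w" "0 < a u u'"
          using tree_connected[of "T w'" "T w' \<inter> T w"] T(1,2) w z(1) by (metis (no_types, lifting)
              IntE IntI Int_lower1 empty_iff mem_Collect_eq)
        moreover have "u' \<in> F - T w" using calculation(2) T(3) w by blast
        ultimately show False using T(4)[of w u u'] w by simp
      qed
      then have "deg s {w, w'} \<le> deg s (T w)"
        using T(2) w finT by (intro deg_mono) auto
      then show False using s1[of w] w by (simp add: deg_def)
    qed
    then show ?thesis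
      using z(2) finite_F by (auto intro!: card_inj_on_le[of z] simp: Z\<^sub>0_def)
  qed
  finally show ?thesis .
qed

definition E :: nat where
  "E = (\<Sum>x\<in>Y \<union> S. deg x F)"

lemma card_with_neighbour_le:
  assumes "finite B" "\<And>z. z \<in> C \<Longrightarrow> z \<in> F \<and> (\<exists>u\<in>B. 0 < a z u)"
  shows "card C \<le> (\<Sum>u\<in>B. deg u F)"
proof -
  have C: "C \<subseteq> F" using assms(2) by blast
  then have "finite C" using finite_F finite_subset by blast
  have "(\<Sum>z\<in>C. 1) \<le> (\<Sum>z\<in>C. deg z B)"
    using assms(2) deg_pos_iff[OF assms(1)] by (intro sum_mono) (simp add: Suc_le_eq)
  also have "\<dots> \<le> (\<Sum>z\<in>F. deg z B)"
    using C finite_F by (intro sum_mono2) auto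
  also have "\<dots> = (\<Sum>u\<in>B. deg u F)" by (rule sum_deg_swap)
  finally show ?thesis by simp
qed

text \<open>The degree bound gives at most \<open>k * k\<close> edges at \<open>Y\<close>. This also
  bounds \<open>card Z\<^sub>0\<close>, hence the degree into \<open>F\<close> of each of the at
  most \<open>k\<close> vertices of \<open>S\<close>.\<close>

lemma E_le:
  assumes low: "\<And>v. v \<in> K \<Longrightarrow> deg v A \<le> k"
  shows "E \<le> 2 * k ^ 3"
proof -
  have "(\<Sum>y\<in>Y. deg y F) \<le> (\<Sum>y\<in>Y. k)"
  proof (intro sum_mono)
    fix y assume "y \<in> Y"
    then show "deg y F \<le> k"
      using low[of y] deg_mono[OF finites(1), of F y] A_split(1) by (fastforce simp: Y_def)
  qed
  also have "\<dots> \<le> k * k" using card_Y_le by simp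
  finally have Y: "(\<Sum>y\<in>Y. deg y F) \<le> k * k" .
  have "card Z\<^sub>0 \<le> (\<Sum>y\<in>Y. deg y F)"
    by (rule card_with_neighbour_le) (auto simp: Z\<^sub>0_def finite_Y)
  with Y have Z: "card Z\<^sub>0 \<le> k * k" by simp
  have "(\<Sum>s\<in>S. deg s F) \<le> (\<Sum>s\<in>S. k * k)"
    using deg_S_le Z order_trans by (intro sum_mono) blast
  also have "\<dots> \<le> k * (k * k)" using card_S_le by simp
  finally have "E \<le> k * k + k * (k * k)"
    using Y A_split(3) finite_Y finites by (simp add: E_def sum.union_disjoint)
  also have "\<dots> \<le> 2 * k ^ 3" by (cases k) (auto simp: power3_eq_cube)
  finally show ?thesis .
qed

text \<open>
  A vertex of degree two lies on a chain of such vertices, all contained in the same cores, and the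
  chain ends next to a branching vertex or a vertex of \<open>X\<close>.
\<close>

lemma transversal:
  assumes low: "\<And>v. v \<in> K \<Longrightarrow> deg v A \<le> k"
  shows "\<exists>Z. finite Z \<and> card Z \<le> 11 * k ^ 3 \<and>
    (\<forall>v\<in>K. \<exists>z\<in>Z. \<forall>W. core W \<longrightarrow> W \<subseteq> A \<longrightarrow> (v \<in> W \<longleftrightarrow> z \<in> W))"
proof -
  define B where "B = {v \<in> F. 3 \<le> deg v A}"
  define D where "D = {v \<in> F. deg v A = 2}"
  define D' where "D' = {v \<in> D. \<exists>u\<in>B \<union> (Y \<union> S). 0 < a v u}"
  have fin: "finite B" "finite D" "finite D'" using finite_F by (auto simp: B_def D_def D'_def)
  have "2 \<le> deg v A" if "v \<in> F" for v using that deg_K_ge2 by (simp add: F_def)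
  then have "3 \<le> deg v A \<or> deg v A = 2" if "v \<in> F" for v using that by fastforce
  then have FBD: "F = B \<union> D" unfolding B_def D_def by blast
  have BD: "B \<inter> D = {}" by (auto simp: B_def D_def)
  \<comment> \<open>The degrees over \<open>F\<close> sum to at most \<open>2 * card F + E\<close>,
    so they exceed two by at most \<open>E\<close> in total. Each vertex of \<open>B\<close> has an
    excess of at least one, whence \<open>card B \<le> E\<close> and a degree sum of at most
    \<open>3 * E\<close> on \<open>B\<close>.\<close>
  have "(\<Sum>v\<in>F. deg v A) = vol F + (\<Sum>v\<in>F. deg v (Y \<union> S))"
    using finite_F finite_Y finites
    by (subst A_split(1)) (simp add: deg_Un[OF _ _ A_split(2)] sum.distrib vol_def)
  also have "(\<Sum>v\<in>F. deg v (Y \<union> S)) = E" unfolding E_def by (rule sum_deg_swap)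
  also have "vol F + E \<le> 2 * card F + E" using acyclic_vol_le[OF finite_F acyclic_F] by simp
  finally have "(\<Sum>v\<in>B. deg v A) + (\<Sum>v\<in>D. deg v A) \<le> 2 * (card B + card D) + E"
    using fin BD by (simp add: FBD sum.union_disjoint card_Un_disjoint)
  moreover have "(\<Sum>v\<in>D. deg v A) = 2 * card D" by (simp add: D_def)
  moreover have "(\<Sum>v\<in>B. 3) \<le> (\<Sum>v\<in>B. deg v A)" by (intro sum_mono) (simp add: B_def)
  ultimately have B: "card B \<le> E" "(\<Sum>v\<in>B. deg v A) \<le> 3 * E" by simp_all
  \<comment> \<open>The vertices of \<open>B\<close> contribute at most \<open>3 * E\<close> by
    their degree sum, and those of \<open>Y \<union> S\<close> contribute \<open>E\<close>.\<close>
  have "card D' \<le> (\<Sum>u\<in>B \<union> (Y \<union> S). deg u F)"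
    using fin finite_Y finites by (intro card_with_neighbour_le) (auto simp: D'_def D_def)
  also have "\<dots> = (\<Sum>u\<in>B. deg u F) + E"
    using fin finite_Y finites FBD A_split(2) unfolding E_def by (intro sum.union_disjoint) auto
  also have "(\<Sum>u\<in>B. deg u F) \<le> (\<Sum>u\<in>B. deg u A)"
    by (intro sum_mono deg_mono finites) (subst A_split(1), blast)
  finally have D': "card D' \<le> 4 * E" using B(2) by simp
  \<comment> \<open>The constant 11 comes from \<open>k + E + 4 * E\<close> with
    \<open>E \<le> 2 * k ^ 3\<close>.\<close>
  have "card (Y \<union> B \<union> D') \<le> card Y + card B + card D'"
    using card_Un_le[of "Y \<union> B" D'] card_Un_le[of Y B] by linarith
  also have "\<dots> \<le> k + 5 * E" using card_Y_le B(1) D' by simp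
  also have "\<dots> \<le> 11 * k ^ 3" using E_le[OF low] by (cases k) (auto simp: power3_eq_cube)
  finally have card: "card (Y \<union> B \<union> D') \<le> 11 * k ^ 3" .
  have "\<exists>z\<in>Y \<union> B \<union> D'. \<forall>W. core W \<longrightarrow> W \<subseteq> A \<longrightarrow> (v \<in> W \<longleftrightarrow> z \<in> W)" if v: "v \<in> K" for v
  proof (cases "v \<in> Y \<union> B")
    case True
    then show ?thesis by blast
  next
    case False
    then have vD: "v \<in> D" using v FBD by (auto simp: F_def Y_def)
    have DF: "D \<subseteq> F" and DA: "D \<subseteq> A" unfolding A_split(1) by (auto simp: D_def)
    obtain P where P: "tree P" "v \<in> P" "P \<subseteq> D" "\<And>t u. t \<in> P \<Longrightarrow> u \<in> D - P \<Longrightarrow> a t u = 0"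
      using maximal_tree[OF fin(2) acyclic_subset[OF acyclic_F DF] vD] by metis
    have finP: "finite P" using P(1) by (simp add: tree_def)
    have PA: "P \<subseteq> A" using P(3) DA by blast
    have deg2: "deg p A = 2" if "p \<in> P" for p using that P(3) by (auto simp: D_def)
    \<comment> \<open>A chain without an edge leaving it inside \<open>A\<close> would be a core by
      itself, which a tree is not.\<close>
    have "\<exists>z\<in>P. \<exists>u\<in>A - P. 0 < a z u"
    proof (rule ccontr)
      assume "\<not> ?thesis"
      then have "deg p (A - P) = 0" if "p \<in> P" for p using that by (simp add: deg_def)
      then have "deg p P = 2" if "p \<in> P" for p
        using that deg2[OF that] deg_Un[of P "A - P" p] finP finites PA by (simp add: Un_absorb1)
      then have "core P" by (simp add: core_def)
      then show False using P(1) by (auto simp: tree_def acyclic_def)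
    qed
    then obtain z u where z: "z \<in> P" "u \<in> A - P" "0 < a z u" by blast
    \<comment> \<open>\<open>P\<close> is a component of \<open>D\<close>, so its outside neighbour
      \<open>u\<close> is branching or chosen, and \<open>z\<close> is counted in
      \<open>D'\<close>.\<close>
    then have "u \<notin> D" using P(4)[of z u] by auto
    then have "u \<in> B \<union> (Y \<union> S)" using z(2) unfolding A_split(1) FBD by blast
    then have "z \<in> D'" using z P(3) by (auto simp: D'_def)
    moreover have "v \<in> W \<longleftrightarrow> z \<in> W" if "core W" "W \<subseteq> A" for W
      using core_contains_chain[OF P(1) PA finites(1) deg2 that] P(2) z(1) by blast
    ultimately show ?thesis by blast
  qed
  then show ?thesis
    using card fin finite_Y by (intro exI[of _ "Y \<union> B \<union> D'"]) auto
qed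

end

section \<open>Cycles of a multigraph\<close>

definition adj :: "'a mgraph \<Rightarrow> 'a \<Rightarrow> 'a \<Rightarrow> nat" where
  "adj G u v = count (edges G) {u, v}"

lemma weighted_graph_adj:
  assumes "multigraph G"
  shows "weighted_graph (adj G)"
proof
  show "adj G u v = adj G v u" for u v by (simp add: adj_def insert_commute)
  have "{v, v} \<notin># edges G" for v using assms by (fastforce simp: multigraph_def)
  then show "adj G v v = 0" for v by (simp add: adj_def not_in_iff)
qed

locale mgraph_cores =
  fixes G :: "'a mgraph"
  assumes mgraph: "multigraph G"
begin

sublocale weighted_graph "adj G"
  using mgraph by (rule weighted_graph_adj)

lemma finite_verts: "finite (verts G)"
  using mgraph by (simp add: multigraph_def)

text \<open>Each vertex of a cycle is an end of two of its edges. In length two both go to the same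
  neighbour, so the multiplicity is counted; otherwise predecessor and successor are different
  vertices.\<close>

lemma core_cycle:
  assumes "is_cycle G vs"
  shows "core (set vs)"
  unfolding core_def
proof
  fix w assume "w \<in> set vs"
  let ?m = "length vs"
  have cyc: "2 \<le> ?m" "distinct vs" "cycle_edges vs \<subseteq># edges G"
    using assms by (auto simp: is_cycle_def)
  have le: "count (cycle_edges vs) {u, v} \<le> adj G u v" for u v
    using cyc(3) by (simp add: adj_def mset_subset_eq_count)
  obtain i where i: "i < ?m" "w = vs ! i" using \<open>w \<in> set vs\<close> by (metis in_set_conv_nth)
  show "2 \<le> deg w (set vs)"
  proof (cases "?m = 2")
    case True
    then obtain x y where vs: "vs = [x, y]"
      by (metis One_nat_def Suc_1 length_0_conv length_Suc_conv)
    then have "cycle_edges vs = {#{x, y}, {x, y}#}"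
      by (simp add: cycle_edges_def insert_commute)
    then have "2 \<le> adj G x y" using le[of x y] by simp
    then show ?thesis
      using \<open>w \<in> set vs\<close> cyc(2) vs by (auto simp: deg_def sym[of y x])
  next
    case False
    define j where "j = (if Suc i = ?m then 0 else Suc i)"
    define p where "p = (if i = 0 then ?m - 1 else i - 1)"
    have jp: "j < ?m" "p < ?m" "j \<noteq> p" "Suc i mod ?m = j" "Suc p mod ?m = i"
      using i(1) cyc(1) False by (auto simp: j_def p_def)
    have mem: "{vs ! q, vs ! (Suc q mod ?m)} \<in># cycle_edges vs" if "q < ?m" for q
      using that by (auto simp: cycle_edges_def)
    have "1 \<le> adj G w (vs ! j)"
      using mem[OF i(1)] le[of w "vs ! j"] i(2) jp(4) by (metis count_greater_eq_one_iff le_trans)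
    moreover have "1 \<le> adj G (vs ! p) w"
      using mem[OF jp(2)] le[of "vs ! p" w] i(2) jp(5) by (metis count_greater_eq_one_iff le_trans)
    moreover have "vs ! j \<noteq> vs ! p" using jp cyc(2) by (simp add: nth_eq_iff_index_eq)
    ultimately have "2 \<le> deg w {vs ! j, vs ! p}"
      by (simp add: deg_def sym[of "vs ! p"])
    also have "\<dots> \<le> deg w (set vs)" using jp by (intro deg_mono) auto
    finally show ?thesis .
  qed
qed

definition is_path :: "'a list \<Rightarrow> bool" where
  "is_path vs \<longleftrightarrow> distinct vs \<and> (\<forall>i. Suc i < length vs \<longrightarrow> 0 < adj G (vs ! i) (vs ! Suc i))"

text \<open>From length three on, the edges of a closed path are pairwise distinct, so multiplicity
  one of each suffices for the inclusion of multisets.\<close>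

lemma cycle_if_closed_path:
  assumes path: "is_path vs" and len: "3 \<le> length vs" and sub: "set vs \<subseteq> verts G"
    and closed: "0 < adj G (vs ! (length vs - 1)) (vs ! 0)"
  shows "is_cycle G vs"
proof -
  let ?m = "length vs"
  let ?next = "\<lambda>i. if Suc i = ?m then 0 else Suc i"
  let ?e = "\<lambda>i. {vs ! i, vs ! ?next i}"
  have dist: "distinct vs" using path by (simp add: is_path_def)
  have "map (\<lambda>i. {vs ! i, vs ! (Suc i mod ?m)}) [0..<?m] = map ?e [0..<?m]"
    by (intro map_cong) auto
  then have ce: "cycle_edges vs = mset (map ?e [0..<?m])"
    unfolding cycle_edges_def by (rule arg_cong)
  have "inj_on ?e {0..<?m}"
  proof (rule inj_onI)
    fix i j assume ij: "i \<in> {0..<?m}" "j \<in> {0..<?m}" "?e i = ?e j"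
    have nx: "?next i < ?m" "?next j < ?m" using ij(1,2) len by auto
    \<comment> \<open>Different positions with the same edge would be successors of each other,
      which happens only in length two.\<close>
    from ij(3) have "i = j \<or> (i = ?next j \<and> ?next i = j)"
      using nx ij(1,2) dist by (auto simp only: doubleton_eq_iff nth_eq_iff_index_eq[OF dist] atLeastLessThan_iff)
    then show "i = j" using len by (auto split: if_splits)
  qed
  then have "distinct (map ?e [0..<?m])" by (simp only: distinct_map set_upt distinct_upt simp_thms)
  moreover have "?e i \<in># edges G" if "i < ?m" for i
  proof -
    have "0 < adj G (vs ! i) (vs ! ?next i)"
    proof (cases "Suc i = ?m")
      case True
      then have "i = ?m - 1" by simp
      then show ?thesis using closed True by simp
    qed (use that path in \<open>auto simp: is_path_def\<close>)
    then show ?thesis by (simp add: adj_def)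
  qed
  ultimately have "cycle_edges vs \<subseteq># edges G"
    unfolding ce subseteq_mset_def
    by (auto simp only: distinct_count_atmost_1 set_map set_upt split: if_splits
        intro!: count_greater_eq_one_iff[THEN iffD2] elim!: imageE atLeastLessThan_iff[THEN iffD1, THEN conjE])
  then show ?thesis using dist len sub by (simp add: is_cycle_def)
qed

text \<open>All neighbours in \<open>W\<close> of the first vertex \<open>h\<close> of a longest
  path lie on that path. As \<open>h\<close> has degree at least two, it has a double edge to the
  second vertex \<open>p\<close> or an edge to a later vertex, and both close a cycle.\<close>

lemma core_contains_cycle:
  assumes "core W" "W \<noteq> {}" "W \<subseteq> verts G"
  shows "\<exists>vs. is_cycle G vs \<and> set vs \<subseteq> W"
proof -
  have finW: "finite W" using finite_subset[OF assms(3) finite_verts] .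
  define Q where "Q vs \<longleftrightarrow> is_path vs \<and> vs \<noteq> [] \<and> set vs \<subseteq> W" for vs
  obtain w where "w \<in> W" using assms(2) by blast
  then have "Q [w]" by (simp add: Q_def is_path_def)
  moreover have "length vs < Suc (card W)" if "Q vs" for vs
    using that finW by (metis Q_def card_mono distinct_card is_path_def less_Suc_eq_le)
  ultimately obtain vs where vs: "Q vs" "\<And>us. Q us \<Longrightarrow> length us \<le> length vs"
    using ex_has_greatest_nat[of Q "[w]" length] by metis
  obtain h rest where hr: "vs = h # rest" using vs(1) by (cases vs) (auto simp: Q_def)
  have path: "is_path vs" and hW: "h \<in> W" and vsW: "set vs \<subseteq> W" using vs(1) hr by (auto simp: Q_def)
  have nb: "u \<in> set vs" if "u \<in> W" "0 < adj G h u" for u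
  proof (rule ccontr)
    assume "u \<notin> set vs"
    then have "Q (u # vs)"
      using vs(1) that hr sym[of h u]
      by (auto simp: Q_def is_path_def nth_Cons split: nat.splits)
    then show False using vs(2) by fastforce
  qed
  have deg: "2 \<le> deg h (set vs)"
  proof -
    have "deg h W = deg h (set vs)"
      unfolding deg_def using nb vsW finW by (intro sum.mono_neutral_right) auto
    then show ?thesis using coreD[OF assms(1) hW] by simp
  qed
  obtain p rest' where vs_eq: "vs = h # p # rest'"
    using deg hr by (cases rest) (auto simp: deg_def irrefl)
  show ?thesis
  proof (cases "2 \<le> adj G h p")
    case True
    have "cycle_edges [h, p] = {#{h, p}, {h, p}#}"
      by (simp add: cycle_edges_def insert_commute)
    moreover have "{#{h, p}, {h, p}#} \<subseteq># edges G"
      using True by (auto simp: subseteq_mset_def adj_def)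
    ultimately have "is_cycle G [h, p]"
      using path vsW assms(3) vs_eq by (auto simp: is_cycle_def is_path_def)
    then show ?thesis using vsW vs_eq by (intro exI[of _ "[h, p]"]) auto
  next
    case False
    have dist: "distinct vs" using path by (simp add: is_path_def)
    have "deg h (set vs) = adj G h p + deg h (set rest')"
      using dist vs_eq by (simp add: deg_insert irrefl)
    then have "0 < deg h (set rest')" using deg False by linarith
    then obtain u where u: "u \<in> set rest'" "0 < adj G h u" using deg_pos_iff[of "set rest'"] by auto
    then obtain q where q: "q < length rest'" "u = rest' ! q" by (metis in_set_conv_nth)
    \<comment> \<open>\<open>u\<close> has index \<open>q + 2\<close> in \<open>vs\<close>, so this
      prefix ends with \<open>u\<close>.\<close>
    let ?us = "take (q + 3) vs"
    have len: "length ?us = q + 3" using q(1) vs_eq by simp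
    have "is_cycle G ?us"
    proof (rule cycle_if_closed_path)
      show "is_path ?us" using path by (auto simp: is_path_def)
      show "set ?us \<subseteq> verts G" using vsW assms(3) set_take_subset by fast
      show "3 \<le> length ?us" unfolding len by simp
      show "0 < adj G (?us ! (length ?us - 1)) (?us ! 0)"
        unfolding len using u q vs_eq sym[of h u] by simp
    qed
    moreover have "set ?us \<subseteq> W" using vsW set_take_subset by fast
    ultimately show ?thesis by blast
  qed
qed

lemma one_fvs_iff_hits_twice:
  "one_fvs G X \<longleftrightarrow> X \<subseteq> verts G \<and> hits_twice (verts G) X"
proof -
  have "(\<forall>vs. is_cycle G vs \<longrightarrow> 2 \<le> card (X \<inter> set vs)) \<longleftrightarrow> hits_twice (verts G) X"
  proof
    assume L: "\<forall>vs. is_cycle G vs \<longrightarrow> 2 \<le> card (X \<inter> set vs)"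
    show "hits_twice (verts G) X"
      unfolding hits_twice_def
    proof (intro allI impI)
      fix W assume W: "W \<subseteq> verts G" "core W" "W \<noteq> {}"
      then obtain vs where vs: "is_cycle G vs" "set vs \<subseteq> W" using core_contains_cycle by blast
      have "card (X \<inter> set vs) \<le> card (W \<inter> X)"
        using vs(2) finite_subset[OF W(1) finite_verts] by (intro card_mono) auto
      then show "2 \<le> card (W \<inter> X)" using L vs(1) by fastforce
    qed
  next
    assume R: "hits_twice (verts G) X"
    show "\<forall>vs. is_cycle G vs \<longrightarrow> 2 \<le> card (X \<inter> set vs)"
    proof (intro allI impI)
      fix vs assume vs: "is_cycle G vs"
      then have "set vs \<subseteq> verts G" "set vs \<noteq> {}" by (auto simp: is_cycle_def)
      then show "2 \<le> card (X \<inter> set vs)"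
        using R core_cycle[OF vs] unfolding hits_twice_def Int_commute[of X] by blast
    qed
  qed
  then show ?thesis by (simp add: one_fvs_iff_cycles)
qed

end

section \<open>Symbolic execution of programs\<close>

text \<open>
  Evaluation is deterministic, so a program is executed by rewriting with the functions \<open>val\<close>,
  \<open>okay\<close> and \<open>cost\<close>, which take the results of calls from \<open>call_val\<close>, \<open>call_ok\<close> and \<open>call_cost\<close>.
\<close>

definition call_ok :: "program \<Rightarrow> nat \<Rightarrow> data list \<Rightarrow> bool" where
  "call_ok P f vs \<longleftrightarrow> f < length P \<and> (\<exists>w t. eval P vs (P ! f) w t)"

definition call_val :: "program \<Rightarrow> nat \<Rightarrow> data list \<Rightarrow> data" where
  "call_val P f vs = (THE w. \<exists>t. eval P vs (P ! f) w t)"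

definition call_cost :: "program \<Rightarrow> nat \<Rightarrow> data list \<Rightarrow> nat" where
  "call_cost P f vs = (THE t. \<exists>w. eval P vs (P ! f) w t)"

lemma call_unique:
  assumes "eval P vs (P ! f) w t"
  shows "call_val P f vs = w" "call_cost P f vs = t"
proof -
  show "call_val P f vs = w"
    unfolding call_val_def
  proof (rule the_equality)
    show "w' = w" if "\<exists>t. eval P vs (P ! f) w' t" for w'
      using that eval_deterministic(1)[OF assms] by blast
  qed (use assms in blast)
  show "call_cost P f vs = t"
    unfolding call_cost_def
  proof (rule the_equality)
    show "t' = t" if "\<exists>w. eval P vs (P ! f) w t'" for t'
      using that eval_deterministic(1)[OF assms] by blast
  qed (use assms in blast)
qed

lemma eval_call_body:
  assumes "call_ok P f vs"
  shows "eval P vs (P ! f) (call_val P f vs) (call_cost P f vs)"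
proof -
  obtain w t where "eval P vs (P ! f) w t" using assms by (auto simp: call_ok_def)
  then show ?thesis using call_unique by metis
qed

fun the_num :: "data \<Rightarrow> int" where
  "the_num (Num m) = m" | "the_num _ = 0"

fun left :: "data \<Rightarrow> data" where
  "left (Pair v w) = v" | "left _ = Null"

fun right :: "data \<Rightarrow> data" where
  "right (Pair v w) = w" | "right _ = Null"

fun is_num :: "data \<Rightarrow> bool" where
  "is_num (Num m) = True" | "is_num _ = False"

fun is_pair :: "data \<Rightarrow> bool" where
  "is_pair (Pair v w) = True" | "is_pair _ = False"

fun val :: "program \<Rightarrow> data list \<Rightarrow> exp \<Rightarrow> data" where
  "val P env (Var i) = env ! i"
| "val P env (Lit n) = Num n"
| "val P env Empty = Null"
| "val P env (Cons_of a b) = Pair (val P env a) (val P env b)"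
| "val P env (Head a) = left (val P env a)"
| "val P env (Tail a) = right (val P env a)"
| "val P env (Add a b) = Num (the_num (val P env a) + the_num (val P env b))"
| "val P env (Sub a b) = Num (the_num (val P env a) - the_num (val P env b))"
| "val P env (If_null a b c) = (if val P env a = Null then val P env b else val P env c)"
| "val P env (If_less a b c d) =
    (if the_num (val P env a) < the_num (val P env b) then val P env c else val P env d)"
| "val P env (Let a b) = val P (val P env a # env) b"
| "val P env (Call f as) = call_val P f (map (val P env) as)"

fun okay :: "program \<Rightarrow> data list \<Rightarrow> exp \<Rightarrow> bool" where
  "okay P env (Var i) = (i < length env)"
| "okay P env (Lit n) = True"
| "okay P env Empty = True"
| "okay P env (Cons_of a b) = (okay P env a \<and> okay P env b)"
| "okay P env (Head a) = (okay P env a \<and> is_pair (val P env a))"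
| "okay P env (Tail a) = (okay P env a \<and> is_pair (val P env a))"
| "okay P env (Add a b) =
    (okay P env a \<and> okay P env b \<and> is_num (val P env a) \<and> is_num (val P env b))"
| "okay P env (Sub a b) =
    (okay P env a \<and> okay P env b \<and> is_num (val P env a) \<and> is_num (val P env b))"
| "okay P env (If_null a b c) =
    (okay P env a \<and> (if val P env a = Null then okay P env b else okay P env c))"
| "okay P env (If_less a b c d) =
    (okay P env a \<and> okay P env b \<and> is_num (val P env a) \<and> is_num (val P env b) \<and>
     (if the_num (val P env a) < the_num (val P env b) then okay P env c else okay P env d))"
| "okay P env (Let a b) = (okay P env a \<and> okay P (val P env a # env) b)"
| "okay P env (Call f as) = (list_all (okay P env) as \<and> call_ok P f (map (val P env) as))"

fun cost :: "program \<Rightarrow> data list \<Rightarrow> exp \<Rightarrow> nat" where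
  "cost P env (Var i) = 1"
| "cost P env (Lit n) = 1"
| "cost P env Empty = 1"
| "cost P env (Cons_of a b) = cost P env a + cost P env b + 1"
| "cost P env (Head a) = cost P env a + 1"
| "cost P env (Tail a) = cost P env a + 1"
| "cost P env (Add a b) = cost P env a + cost P env b + 1"
| "cost P env (Sub a b) = cost P env a + cost P env b + 1"
| "cost P env (If_null a b c) =
    cost P env a + (if val P env a = Null then cost P env b else cost P env c) + 1"
| "cost P env (If_less a b c d) = cost P env a + cost P env b +
    (if the_num (val P env a) < the_num (val P env b) then cost P env c else cost P env d) + 1"
| "cost P env (Let a b) = cost P env a + cost P (val P env a # env) b + 1"
| "cost P env (Call f as) =
    sum_list (map (cost P env) as) + call_cost P f (map (val P env) as) + 1"

lemma is_numD: "is_num v \<Longrightarrow> v = Num (the_num v)"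
  by (cases v) auto

lemma is_pairD: "is_pair v \<Longrightarrow> v = Pair (left v) (right v)"
  by (cases v) auto

lemma evals_map:
  assumes "\<And>e. e \<in> set es \<Longrightarrow> eval P env e (val P env e) (cost P env e)"
  shows "evals P env es (map (val P env) es) (sum_list (map (cost P env) es))"
  using assms by (induction es) (auto intro: eval_evals.intros)

lemma eval_val_cost: "okay P env e \<Longrightarrow> eval P env e (val P env e) (cost P env e)"
proof (induction e arbitrary: env)
  case (Head e)
  then have "eval P env e (Pair (left (val P env e)) (right (val P env e))) (cost P env e)"
    by (metis is_pairD okay.simps(5))
  then show ?case unfolding val.simps cost.simps by (rule eval_Head)
next
  case (Tail e)
  then have "eval P env e (Pair (left (val P env e)) (right (val P env e))) (cost P env e)"
    by (metis is_pairD okay.simps(6))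
  then show ?case unfolding val.simps cost.simps by (rule eval_Tail)
next
  case (Add e1 e2)
  then have "eval P env e1 (Num (the_num (val P env e1))) (cost P env e1)"
    "eval P env e2 (Num (the_num (val P env e2))) (cost P env e2)"
    by (metis is_numD okay.simps(7))+
  then show ?case unfolding val.simps cost.simps by (rule eval_Add)
next
  case (Sub e1 e2)
  then have "eval P env e1 (Num (the_num (val P env e1))) (cost P env e1)"
    "eval P env e2 (Num (the_num (val P env e2))) (cost P env e2)"
    by (metis is_numD okay.simps(8))+
  then show ?case unfolding val.simps cost.simps by (rule eval_Sub)
next
  case (If_null a b c)
  have "eval P env (if val P env a = Null then b else c) (val P env (If_null a b c))
      (if val P env a = Null then cost P env b else cost P env c)"
    using If_null by simp
  with If_null show ?case unfolding cost.simps by (intro eval_If_null) simp_all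
next
  case (If_less a b c d)
  have "eval P env a (Num (the_num (val P env a))) (cost P env a)"
    "eval P env b (Num (the_num (val P env b))) (cost P env b)"
    using If_less by (metis is_numD okay.simps(10))+
  moreover have "eval P env (if the_num (val P env a) < the_num (val P env b) then c else d)
      (val P env (If_less a b c d))
      (if the_num (val P env a) < the_num (val P env b) then cost P env c else cost P env d)"
    using If_less by simp
  ultimately show ?case unfolding cost.simps by (rule eval_If_less)
next
  case (Call f as)
  then have "evals P env as (map (val P env) as) (sum_list (map (cost P env) as))"
    by (intro evals_map) (auto simp: list_all_iff)
  then show ?case
    using Call.prems eval_call_body[of P f "map (val P env) as"]
    unfolding val.simps cost.simps by (intro eval_Call) (auto simp: call_ok_def)
next
  case (Cons_of a b)
  then show ?case unfolding val.simps cost.simps by (intro eval_Cons_of) simp_all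
next
  case (Let a b)
  then show ?case unfolding val.simps cost.simps by (intro eval_Let[where v = "val P env a"]) simp_all
qed (auto intro: eval_evals.intros simp del: One_nat_def)

definition computes :: "program \<Rightarrow> nat \<Rightarrow> data list \<Rightarrow> data \<Rightarrow> nat \<Rightarrow> bool" where
  "computes P f vs w b \<longleftrightarrow> call_ok P f vs \<and> call_val P f vs = w \<and> call_cost P f vs \<le> b"

text \<open>The rule for unfolding one function body. Calls inside it are resolved by further
  \<open>computes\<close> facts, such as the induction hypothesis, taken apart with
  \<open>computesD\<close>.\<close>

lemma computesI:
  assumes "f < length P" "P ! f = e" "okay P vs e" "val P vs e = w" "cost P vs e \<le> b"
  shows "computes P f vs w b"
proof -
  have "eval P vs (P ! f) (val P vs e) (cost P vs e)"
    using eval_val_cost[OF assms(3)] assms(2) by simp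
  from this call_unique[OF this] show ?thesis
    using assms unfolding computes_def call_ok_def by auto
qed

lemma computesD:
  assumes "computes P f vs w b"
  shows "call_ok P f vs" "call_val P f vs = w" "call_cost P f vs \<le> b"
  using assms by (auto simp: computes_def)

lemma computes_mono: "computes P f vs w b \<Longrightarrow> b \<le> b' \<Longrightarrow> computes P f vs w b'"
  by (auto simp: computes_def)

lemma runs_if_computes:
  assumes "computes P 0 vs w b"
  shows "\<exists>t\<le>b. runs P vs w t"
  using assms eval_call_body[of P 0 vs] by (auto simp: computes_def call_ok_def runs_def)

section \<open>The program and its subroutines\<close>

text \<open>
  Arguments come in the order graph, vertex set \<open>A\<close>, list to be traversed; \<open>Null\<close> and \<open>Num 1\<close> are the
  truth values.  The arguments of \<open>solve_body\<close> are the graph, \<open>V\<close>, \<open>S\<close>, the number of vertices that may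
  still be chosen, \<open>k\<close>, and the bound \<open>11 k\<^sup>3\<close> on the number of candidates; \<open>try_body\<close> has the list of
  candidates in addition.
\<close>

definition nth_body :: exp where
  "nth_body = If_less (Var 1) (Lit 1) (Head (Var 0)) (Call 1 [Tail (Var 0), Sub (Var 1) (Lit 1)])"

text \<open>The language has no equality test on numbers, so two comparisons decide whether the head
  of the list is the one sought.\<close>

definition mem_body :: exp where
  "mem_body = If_null (Var 1) Empty
    (If_less (Var 0) (Head (Var 1)) (Call 2 [Var 0, Tail (Var 1)])
      (If_less (Head (Var 1)) (Var 0) (Call 2 [Var 0, Tail (Var 1)]) (Lit 1)))"

definition degree_body :: exp where
  "degree_body = If_null (Var 1) (Lit 0)
    (Add (Call 1 [Var 0, Head (Var 1)]) (Call 3 [Var 0, Tail (Var 1)]))"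

definition prune_body :: exp where
  "prune_body = If_null (Var 2) Empty
    (If_less (Call 3 [Call 1 [Var 0, Head (Var 2)], Var 1]) (Lit 2)
      (Call 4 [Var 0, Var 1, Tail (Var 2)])
      (Cons_of (Head (Var 2)) (Call 4 [Var 0, Var 1, Tail (Var 2)])))"

text \<open>The last list acts as a clock: one round of pruning for each of its elements.\<close>

definition core_body :: exp where
  "core_body = If_null (Var 2) (Var 1)
    (Call 5 [Var 0, Call 4 [Var 0, Var 1, Var 1], Tail (Var 2)])"

definition diff_body :: exp where
  "diff_body = If_null (Var 0) Empty
    (If_null (Call 2 [Head (Var 0), Var 1])
      (Cons_of (Head (Var 0)) (Call 6 [Tail (Var 0), Var 1]))
      (Call 6 [Tail (Var 0), Var 1]))"

definition append_body :: exp where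
  "append_body = If_null (Var 0) (Var 1) (Cons_of (Head (Var 0)) (Call 7 [Tail (Var 0), Var 1]))"

definition cores_body :: exp where
  "cores_body = If_null (Var 2) (Call 5 [Var 0, Var 1, Var 1])
    (Let (Cons_of (Head (Var 2)) (Var 1))
      (Call 7 [Call 5 [Var 1, Var 0, Var 0], Call 8 [Var 1, Var 2, Tail (Var 3)]]))"

definition high_body :: exp where
  "high_body = If_null (Var 2) Empty
    (If_less (Var 3) (Call 3 [Call 1 [Var 0, Head (Var 2)], Var 1])
      (Cons_of (Head (Var 2)) Empty)
      (Call 9 [Var 0, Var 1, Tail (Var 2), Var 3]))"

definition dominated_body :: exp where
  "dominated_body = If_null (Var 3) Empty
    (Let (Call 6 [Var 1, Cons_of (Head (Var 3)) Empty])
      (If_null (Call 2 [Var 3, Call 5 [Var 1, Var 0, Var 0]]) (Lit 1)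
        (Call 10 [Var 1, Var 2, Var 3, Tail (Var 4)])))"

definition candidates_body :: exp where
  "candidates_body = If_null (Var 2) Empty
    (If_null (Call 10 [Var 0, Var 1, Head (Var 2), Tail (Var 2)])
      (Cons_of (Head (Var 2)) (Call 11 [Var 0, Var 1, Tail (Var 2)]))
      (Call 11 [Var 0, Var 1, Tail (Var 2)]))"

definition length_body :: exp where
  "length_body = If_null (Var 0) (Lit 0) (Add (Lit 1) (Call 12 [Tail (Var 0)]))"

definition times_body :: exp where
  "times_body = If_less (Var 0) (Lit 1) (Lit 0) (Add (Var 1) (Call 13 [Sub (Var 0) (Lit 1), Var 1]))"

definition vertices_body :: exp where
  "vertices_body = If_null (Var 0) Empty
    (Cons_of (Var 1) (Call 14 [Tail (Var 0), Add (Var 1) (Lit 1)]))"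

text \<open>The bindings are, in order, \<open>V\<close> without \<open>S\<close>, \<open>K\<close>,
  \<open>A\<close>, the list from \<open>high_body\<close> and the candidates; each shifts the
  arguments by one index. The nested differences amount to intersecting \<open>V\<close> without
  \<open>S\<close> with the vertices found by \<open>cores_body\<close>.\<close>

definition solve_body :: exp where
  "solve_body =
    Let (Call 6 [Var 1, Var 2])
    (Let (Call 6 [Var 0, Call 6 [Var 0, Call 8 [Var 1, Var 0, Var 3]]])
    (If_null (Var 0) (Cons_of (Var 4) Empty)
    (If_less (Var 5) (Lit 1) Empty
    (Let (Call 7 [Var 0, Var 4])
    (Let (Call 9 [Var 3, Var 0, Var 1, Var 7])
    (If_null (Var 0)
      (Let (Call 11 [Var 4, Var 1, Var 2])
        (If_less (Var 10) (Call 12 [Var 0]) Empty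
          (Call 16 [Var 5, Var 6, Var 7, Var 8, Var 9, Var 10, Var 0])))
      (Call 16 [Var 4, Var 5, Var 6, Var 7, Var 8, Var 9, Var 0])))))))"

definition try_body :: exp where
  "try_body = If_null (Var 6) Empty
    (Let (Call 15 [Var 0, Var 1, Cons_of (Head (Var 6)) (Var 2), Sub (Var 3) (Lit 1), Var 4, Var 5])
      (If_null (Var 0) (Call 16 [Var 1, Var 2, Var 3, Var 4, Var 5, Var 6, Tail (Var 7)]) (Var 0)))"

text \<open>The budget is \<open>k\<close> minus the size of \<open>S\<close>. In the absence of
  multiplication, \<open>11 k^3\<close> is formed by three rounds of \<open>k\<close>
  additions.\<close>

definition main_body :: exp where
  "main_body = Let (Sub (Var 2) (Call 12 [Var 1]))
    (If_less (Var 0) (Lit 0) Empty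
      (Call 15 [Var 1, Call 14 [Var 1, Lit 0], Var 2, Var 0, Var 3,
        Call 13 [Var 3, Call 13 [Var 3, Call 13 [Var 3, Lit 11]]]]))"

definition prog :: program where
  "prog = [main_body, nth_body, mem_body, degree_body, prune_body, core_body, diff_body,
    append_body, cores_body, high_body, dominated_body, candidates_body, length_body, times_body,
    vertices_body, solve_body, try_body]"

lemma prog_nth:
  "prog ! 0 = main_body" "prog ! Suc 0 = nth_body" "prog ! 2 = mem_body" "prog ! 3 = degree_body"
  "prog ! 4 = prune_body" "prog ! 5 = core_body" "prog ! 6 = diff_body" "prog ! 7 = append_body"
  "prog ! 8 = cores_body" "prog ! 9 = high_body" "prog ! 10 = dominated_body"
  "prog ! 11 = candidates_body" "prog ! 12 = length_body" "prog ! 13 = times_body"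
  "prog ! 14 = vertices_body" "prog ! 15 = solve_body" "prog ! 16 = try_body"
  "length prog = 17"
  by (simp_all add: prog_def)

section \<open>Correctness and running time of the list operations\<close>

lemma encode_nats_simps [simp]:
  "encode_nats [] = Null" "encode_nats (x # xs) = Pair (Num (int x)) (encode_nats xs)"
  by (simp_all add: encode_nats_def)

lemma encode_nats_eq_Null [simp]: "encode_nats xs = Null \<longleftrightarrow> xs = []"
  by (cases xs) auto

lemma nth_computes:
  "i < length ds \<Longrightarrow> computes prog 1 [encode_list ds, Num (int i)] (ds ! i) (10 * i + 10)"
proof (induction ds arbitrary: i)
  case (Cons d ds)
  show ?case
  proof (cases i)
    case 0
    show ?thesis
      by (rule computesI[where e = nth_body]) (auto simp: prog_nth nth_body_def 0)
  next
    case (Suc j)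
    note IH = computesD[OF Cons.IH[of j]]
    show ?thesis
      using Cons.prems IH Suc
      by (intro computesI[where e = nth_body]) (auto simp: prog_nth nth_body_def)
  qed
qed simp

lemma mem_computes:
  "computes prog 2 [Num (int x), encode_nats l] (if x \<in> set l then Num 1 else Null) (20 * length l + 10)"
proof (induction l)
  case Nil
  show ?case by (rule computesI[where e = mem_body]) (auto simp: prog_nth mem_body_def)
next
  case (Cons y l)
  show ?case
    using computesD[OF Cons.IH]
    by (intro computesI[where e = mem_body]) (auto simp: prog_nth mem_body_def)
qed

lemma diff_computes:
  "computes prog 6 [encode_nats l, encode_nats m] (encode_nats (filter (\<lambda>x. x \<notin> set m) l))
    (length l * (20 * length m + 40) + 10)"
proof (induction l)
  case Nil
  show ?case by (rule computesI[where e = diff_body]) (auto simp: prog_nth diff_body_def)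
next
  case (Cons y l)
  show ?case
    using computesD[OF Cons.IH] computesD[OF mem_computes[of y m]]
    by (intro computesI[where e = diff_body]) (auto simp: prog_nth diff_body_def)
qed

lemma append_computes:
  "computes prog 7 [encode_nats l, encode_nats m] (encode_nats (l @ m)) (20 * length l + 10)"
proof (induction l)
  case Nil
  show ?case by (rule computesI[where e = append_body]) (auto simp: prog_nth append_body_def)
next
  case (Cons y l)
  show ?case
    using computesD[OF Cons.IH]
    by (intro computesI[where e = append_body]) (auto simp: prog_nth append_body_def)
qed

lemma length_computes:
  "computes prog 12 [encode_nats l] (Num (int (length l))) (10 * length l + 10)"
proof (induction l)
  case Nil
  show ?case by (rule computesI[where e = length_body]) (auto simp: prog_nth length_body_def)
next
  case (Cons y l)
  show ?case
    using computesD[OF Cons.IH]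
    by (intro computesI[where e = length_body]) (auto simp: prog_nth length_body_def)
qed

lemma times_computes:
  "computes prog 13 [Num (int x), Num (int y)] (Num (int (x * y))) (10 * x + 10)"
proof (induction x)
  case 0
  show ?case by (rule computesI[where e = times_body]) (auto simp: prog_nth times_body_def)
next
  case (Suc x)
  show ?case
    using computesD[OF Suc.IH]
    by (intro computesI[where e = times_body]) (auto simp: prog_nth times_body_def)
qed

lemma vertices_computes:
  "computes prog 14 [encode_list ds, Num (int i)] (encode_nats [i..<i + length ds])
    (20 * length ds + 10)"
proof (induction ds arbitrary: i)
  case Nil
  show ?case by (rule computesI[where e = vertices_body]) (auto simp: prog_nth vertices_body_def)
next
  case (Cons d ds)
  have "[i..<i + length (d # ds)] = i # [Suc i..<Suc i + length ds]"
    by (simp add: upt_conv_Cons del: upt_Suc)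
  then show ?case
    using computesD[OF Cons.IH[of "Suc i"]]
    by (intro computesI[where e = vertices_body])
      (auto simp: prog_nth vertices_body_def add.commute simp del: upt_Suc)
qed

definition t_degree :: "nat \<Rightarrow> nat" where
  "t_degree n = n * (10 * n + 20) + 10"

definition t_prune :: "nat \<Rightarrow> nat" where
  "t_prune n = n * (10 * n + t_degree n + 50) + 10"

definition t_core :: "nat \<Rightarrow> nat" where
  "t_core n = n * (t_prune n + 20) + 10"

definition t_cores :: "nat \<Rightarrow> nat" where
  "t_cores n = n * (t_core n + 20 * n + 50) + t_core n + 10"

definition t_high :: "nat \<Rightarrow> nat" where
  "t_high n = n * (10 * n + t_degree n + 50) + 10"

definition t_dominated :: "nat \<Rightarrow> nat" where
  "t_dominated n = n * (80 * n + t_core n + 120) + 10"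

definition t_candidates :: "nat \<Rightarrow> nat" where
  "t_candidates n = n * (t_dominated n + 50) + 10"

section \<open>Pruning and domination on the adjacency matrix\<close>

locale matrix_graph = weighted_graph a for a :: "nat \<Rightarrow> nat \<Rightarrow> nat" +
  fixes n :: nat
begin

definition row :: "nat \<Rightarrow> data" where
  "row u = encode_nats (map (a u) [0..<n])"

definition matrix :: data where
  "matrix = encode_list (map row [0..<n])"

text \<open>Such lists represent vertex sets; as they are distinct, a loop over them has at most
  \<open>n\<close> rounds.\<close>

definition small :: "nat list \<Rightarrow> bool" where
  "small l \<longleftrightarrow> distinct l \<and> set l \<subseteq> {0..<n}"

lemma small_length: "small l \<Longrightarrow> length l \<le> n"
  using card_mono[of "{0..<n}" "set l"] by (simp add: small_def distinct_card)

lemma small_filter: "small l \<Longrightarrow> small (filter p l)"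
  by (auto simp: small_def)

lemma row_computes:
  "u < n \<Longrightarrow> computes prog 1 [matrix, Num (int u)] (row u) (10 * n)"
  using nth_computes[of u "map row [0..<n]"] computes_mono by (fastforce simp: matrix_def)

lemma entry_computes:
  "v < n \<Longrightarrow> computes prog 1 [row u, Num (int v)] (Num (int (a u v))) (10 * n)"
  using nth_computes[of v "map (\<lambda>x. Num (int x)) (map (a u) [0..<n])"] computes_mono
  by (fastforce simp: row_def encode_nats_def)

lemma degree_computes:
  assumes "small l"
  shows "computes prog 3 [row u, encode_nats l] (Num (int (deg u (set l)))) (t_degree n)"
proof -
  have "computes prog 3 [row u, encode_nats l] (Num (int (deg u (set l))))
      (length l * (10 * n + 20) + 10)"
    using assms
  proof (induction l)
    case Nil
    show ?case
      by (rule computesI[where e = degree_body]) (auto simp: prog_nth degree_body_def deg_def)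
  next
    case (Cons y l)
    then have y: "y < n" "y \<notin> set l" "small l" by (auto simp: small_def)
    show ?case
      using computesD[OF Cons.IH[OF y(3)]] computesD[OF entry_computes[OF y(1), of u]] y
      by (intro computesI[where e = degree_body])
        (auto simp: prog_nth degree_body_def deg_insert)
  qed
  then show ?thesis
    by (rule computes_mono) (use small_length[OF assms] in \<open>simp add: t_degree_def\<close>)
qed

abbreviation prune :: "nat list \<Rightarrow> nat list" where
  "prune A \<equiv> filter (\<lambda>v. 2 \<le> deg v (set A)) A"

lemma prune_computes:
  assumes "small A"
  shows "computes prog 4 [matrix, encode_nats A, encode_nats A] (encode_nats (prune A)) (t_prune n)"
proof -
  have "computes prog 4 [matrix, encode_nats A, encode_nats l]
      (encode_nats (filter (\<lambda>v. 2 \<le> deg v (set A)) l)) (length l * (10 * n + t_degree n + 50) + 10)"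
    if "small l" for l
    using that
  proof (induction l)
    case Nil
    show ?case by (rule computesI[where e = prune_body]) (auto simp: prog_nth prune_body_def)
  next
    case (Cons y l)
    then have y: "y < n" "small l" by (auto simp: small_def)
    show ?case
      using computesD[OF Cons.IH[OF y(2)]] computesD[OF row_computes[OF y(1)]]
        computesD[OF degree_computes[OF assms, of y]]
      by (intro computesI[where e = prune_body]) (auto simp: prog_nth prune_body_def)
  qed
  from this[OF assms] show ?thesis
    by (rule computes_mono) (use small_length[OF assms] in \<open>simp add: t_prune_def\<close>)
qed

fun iterate_prune :: "nat list \<Rightarrow> nat list \<Rightarrow> nat list" where
  "iterate_prune A [] = A"
| "iterate_prune A (x # l) = iterate_prune (prune A) l"

text \<open>The 2-core of the graph on \<open>A\<close>; the second copy of \<open>A\<close> grants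
  as many rounds of pruning as there are vertices.\<close>

definition core_of :: "nat list \<Rightarrow> nat list" where
  "core_of A = iterate_prune A A"

lemma core_computes:
  assumes "small A"
  shows "computes prog 5 [matrix, encode_nats A, encode_nats A] (encode_nats (core_of A)) (t_core n)"
proof -
  have "computes prog 5 [matrix, encode_nats A, encode_nats l] (encode_nats (iterate_prune A l))
      (length l * (t_prune n + 20) + 10)" for l
    using assms
  proof (induction l arbitrary: A)
    case Nil
    show ?case by (rule computesI[where e = core_body]) (auto simp: prog_nth core_body_def)
  next
    case (Cons y l)
    show ?case
      using computesD[OF Cons.IH[OF small_filter[OF Cons.prems, of "\<lambda>v. 2 \<le> deg v (set A)"]]]
        computesD[OF prune_computes[OF Cons.prems]]
      by (intro computesI[where e = core_body]) (auto simp: prog_nth core_body_def)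
  qed
  from this[of A] show ?thesis
    unfolding core_of_def
    by (rule computes_mono) (use small_length[OF assms] in \<open>simp add: t_core_def\<close>)
qed

lemma iterate_prune_filter: "\<exists>p. iterate_prune A l = filter p A"
proof (induction l arbitrary: A)
  case Nil
  show ?case by (auto intro: exI[of _ "\<lambda>_. True"])
next
  case (Cons x l)
  then obtain p where "iterate_prune (prune A) l = filter p (prune A)" by blast
  then show ?case by auto
qed

lemma iterate_prune_fixed: "prune A = A \<Longrightarrow> iterate_prune A l = A"
  by (induction l) auto

text \<open>A round that changes \<open>A\<close> shortens it, so \<open>length A\<close> rounds
  reach a fixed point of pruning, which is a core.\<close>

lemma core_iterate_prune: "length A \<le> length l \<Longrightarrow> core (set (iterate_prune A l))"
proof (induction l arbitrary: A)
  case (Cons x l)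
  show ?case
  proof (cases "prune A = A")
    case True
    then have "core (set A)" by (auto simp: core_def filter_id_conv)
    then show ?thesis using iterate_prune_fixed[OF True] True by simp
  next
    case False
    then have "length (prune A) < length A"
      by (metis length_filter_less filter_id_conv)
    then show ?thesis using Cons by simp
  qed
qed (simp add: core_def)

text \<open>Pruning never removes a vertex of a core, since its degree in the larger set is also at
  least two.\<close>

lemma sub_iterate_prune:
  assumes "core W"
  shows "W \<subseteq> set A \<Longrightarrow> W \<subseteq> set (iterate_prune A l)"
proof (induction l arbitrary: A)
  case (Cons x l)
  have "2 \<le> deg w (set A)" if "w \<in> W" for w
    using coreD[OF assms that] deg_mono[OF _ Cons.prems, of w] by simp
  then have "W \<subseteq> set (prune A)" using Cons.prems by auto
  then show ?case using Cons.IH[of "prune A"] by simp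
qed simp

lemma small_core_of: "small A \<Longrightarrow> small (core_of A)"
  using iterate_prune_filter[of A A] small_filter by (auto simp: core_of_def)

lemma set_core_of: "v \<in> set (core_of A) \<longleftrightarrow> (\<exists>W\<subseteq>set A. core W \<and> v \<in> W)"
proof -
  have "set (core_of A) \<subseteq> set A"
    using iterate_prune_filter[of A A] by (auto simp: core_of_def)
  moreover have "core (set (core_of A))"
    by (simp add: core_of_def core_iterate_prune)
  ultimately show ?thesis
    using sub_iterate_prune[of _ A A] by (auto simp: core_of_def)
qed

fun cores :: "nat list \<Rightarrow> nat list \<Rightarrow> nat list" where
  "cores U [] = core_of U"
| "cores U (s # S) = core_of (s # U) @ cores U S"

text \<open>A vertex may occur in several of the concatenated parts, so the length cannot be bounded
  through \<open>small\<close> for the whole list.\<close>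

lemma length_cores:
  assumes "small U" "small S" "set U \<inter> set S = {}"
  shows "length (cores U S) \<le> (length S + 1) * n"
  using assms(2,3)
proof (induction S)
  case Nil
  then show ?case using small_length[OF small_core_of[OF assms(1)]] by simp
next
  case (Cons s S)
  then have "small (s # U)" "small S" using assms(1) by (auto simp: small_def)
  then show ?case using Cons small_length[OF small_core_of[of "s # U"]] by simp
qed

lemma cores_computes:
  assumes "small U" "small S" "set U \<inter> set S = {}"
  shows "computes prog 8 [matrix, encode_nats U, encode_nats S] (encode_nats (cores U S)) (t_cores n)"
proof -
  have "computes prog 8 [matrix, encode_nats U, encode_nats S] (encode_nats (cores U S))
      (length S * (t_core n + 20 * n + 50) + t_core n + 10)"
    using assms(2,3)
  proof (induction S)
    case Nil
    show ?case
      using computesD[OF core_computes[OF assms(1)]]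
      by (intro computesI[where e = cores_body]) (auto simp: prog_nth cores_body_def)
  next
    case (Cons s S)
    then have s: "small (s # U)" "small S" "set U \<inter> set S = {}" using assms(1) by (auto simp: small_def)
    show ?case
      using computesD[OF core_computes[OF s(1)]] computesD[OF Cons.IH[OF s(2,3)]]
        computesD[OF append_computes[of "core_of (s # U)" "cores U S"]]
        small_length[OF small_core_of[OF s(1)]]
      by (intro computesI[where e = cores_body]) (auto simp: prog_nth cores_body_def)
  qed
  then show ?thesis
    by (rule computes_mono) (use small_length[OF assms(2)] in \<open>simp add: t_cores_def\<close>)
qed

fun first_high :: "nat list \<Rightarrow> nat \<Rightarrow> nat list \<Rightarrow> nat list" where
  "first_high A k [] = []"
| "first_high A k (v # l) = (if k < deg v (set A) then [v] else first_high A k l)"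

lemma high_computes:
  assumes "small A" "small l"
  shows "computes prog 9 [matrix, encode_nats A, encode_nats l, Num (int k)]
    (encode_nats (first_high A k l)) (t_high n)"
proof -
  have "computes prog 9 [matrix, encode_nats A, encode_nats l, Num (int k)]
    (encode_nats (first_high A k l)) (length l * (10 * n + t_degree n + 50) + 10)"
    using assms(2)
  proof (induction l)
    case Nil
    show ?case by (rule computesI[where e = high_body]) (auto simp: prog_nth high_body_def)
  next
    case (Cons y l)
    then have y: "y < n" "small l" by (auto simp: small_def)
    show ?case
      using computesD[OF Cons.IH[OF y(2)]] computesD[OF row_computes[OF y(1)]]
        computesD[OF degree_computes[OF assms(1), of y]]
      by (intro computesI[where e = high_body]) (auto simp: prog_nth high_body_def)
  qed
  then show ?thesis
    by (rule computes_mono) (use small_length[OF assms(2)] in \<open>simp add: t_high_def\<close>)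
qed

lemma first_high_cases:
  obtains "first_high A k l = []" "\<forall>v\<in>set l. deg v (set A) \<le> k"
  | v where "first_high A k l = [v]" "v \<in> set l" "k < deg v (set A)"
proof -
  have "(first_high A k l = [] \<and> (\<forall>v\<in>set l. deg v (set A) \<le> k)) \<or>
    (\<exists>v\<in>set l. first_high A k l = [v] \<and> k < deg v (set A))"
    by (induction l) auto
  then show ?thesis using that by blast
qed

definition dominates :: "nat list \<Rightarrow> nat \<Rightarrow> nat \<Rightarrow> bool" where
  "dominates A u v \<longleftrightarrow> v \<notin> set (core_of (filter (\<lambda>x. x \<noteq> u) A))"

lemma dominates_iff: "dominates A u v \<longleftrightarrow> (\<forall>W. core W \<longrightarrow> W \<subseteq> set A \<longrightarrow> v \<in> W \<longrightarrow> u \<in> W)"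
  unfolding dominates_def set_core_of by auto

lemma dominated_computes:
  assumes "small A" "small l"
  shows "computes prog 10 [matrix, encode_nats A, Num (int v), encode_nats l]
    (if \<exists>u\<in>set l. dominates A u v then Num 1 else Null) (t_dominated n)"
proof -
  have lenA: "length A \<le> n" by (rule small_length[OF assms(1)])
  have "computes prog 10 [matrix, encode_nats A, Num (int v), encode_nats l]
    (if \<exists>u\<in>set l. dominates A u v then Num 1 else Null) (length l * (80 * n + t_core n + 120) + 10)"
    using assms(2)
  proof (induction l)
    case Nil
    show ?case by (rule computesI[where e = dominated_body]) (auto simp: prog_nth dominated_body_def)
  next
    case (Cons y l)
    then have y: "small l" by (auto simp: small_def)
    let ?B = "filter (\<lambda>x. x \<noteq> y) A"
    have B: "small ?B" using assms(1) by (rule small_filter)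
    show ?case
      using computesD[OF Cons.IH[OF y]] computesD[OF core_computes[OF B]]
        computesD[OF diff_computes[of A "[y]"]] computesD[OF mem_computes[of v "core_of ?B"]]
        small_length[OF small_core_of[OF B]] lenA
      by (intro computesI[where e = dominated_body])
        (auto simp: prog_nth dominated_body_def dominates_def)
  qed
  then show ?thesis
    by (rule computes_mono) (use small_length[OF assms(2)] in \<open>simp add: t_dominated_def\<close>)
qed

text \<open>A vertex yields only to dominating vertices later in the list, so two vertices that
  dominate each other do not eliminate each other.\<close>

fun candidates :: "nat list \<Rightarrow> nat list \<Rightarrow> nat list" where
  "candidates A [] = []"
| "candidates A (v # l) =
    (if \<exists>u\<in>set l. dominates A u v then candidates A l else v # candidates A l)"

lemma candidates_computes:
  assumes "small A" "small l"
  shows "computes prog 11 [matrix, encode_nats A, encode_nats l] (encode_nats (candidates A l))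
    (t_candidates n)"
proof -
  have "computes prog 11 [matrix, encode_nats A, encode_nats l] (encode_nats (candidates A l))
    (length l * (t_dominated n + 50) + 10)"
    using assms(2)
  proof (induction l)
    case Nil
    show ?case by (rule computesI[where e = candidates_body]) (auto simp: prog_nth candidates_body_def)
  next
    case (Cons y l)
    then have y: "small l" by (auto simp: small_def)
    show ?case
      using computesD[OF Cons.IH[OF y]] computesD[OF dominated_computes[OF assms(1) y, of y]]
      by (intro computesI[where e = candidates_body]) (auto simp: prog_nth candidates_body_def)
  qed
  then show ?thesis
    by (rule computes_mono) (use small_length[OF assms(2)] in \<open>simp add: t_candidates_def\<close>)
qed

lemma set_candidates: "set (candidates A l) \<subseteq> set l"
  by (induction l) auto

text \<open>Domination is transitive, and a dropped vertex has a dominating one later in the list,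
  for which the induction hypothesis provides a candidate.\<close>

lemma candidates_dominate:
  "v \<in> set l \<Longrightarrow> \<exists>u\<in>set (candidates A l). dominates A u v"
proof (induction l arbitrary: v)
  case (Cons x l)
  show ?case
  proof (cases "v \<in> set l")
    case True
    then show ?thesis using Cons.IH[of v] by auto
  next
    case False
    then have "v = x" using Cons.prems by simp
    show ?thesis
    proof (cases "\<exists>u\<in>set l. dominates A u v")
      case True
      then obtain u where u: "u \<in> set l" "dominates A u v" by blast
      then obtain w where w: "w \<in> set (candidates A l)" "dominates A w u" using Cons.IH by blast
      have "dominates A w v" using u(2) w(2) by (simp add: dominates_iff)
      then show ?thesis using w(1) by auto
    next
      case False
      moreover have "dominates A v v" by (simp add: dominates_iff)
      ultimately show ?thesis using \<open>v = x\<close> by auto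
    qed
  qed
qed simp

text \<open>Vertices with the same \<open>z\<close> lie on the same cores in \<open>A\<close> and
  dominate each other, so the earlier one is dropped. Hence \<open>z\<close> is injective on the
  candidates.\<close>

lemma length_candidates_le:
  assumes "distinct l" "finite Z"
    and Z: "\<forall>v\<in>set l. \<exists>z\<in>Z. \<forall>W. core W \<longrightarrow> W \<subseteq> set A \<longrightarrow> (v \<in> W \<longleftrightarrow> z \<in> W)"
  shows "length (candidates A l) \<le> card Z"
proof -
  obtain z where z: "\<And>v. v \<in> set l \<Longrightarrow> z v \<in> Z"
    "\<And>v W. v \<in> set l \<Longrightarrow> core W \<Longrightarrow> W \<subseteq> set A \<Longrightarrow> v \<in> W \<longleftrightarrow> z v \<in> W"
    using Z by metis
  have "distinct (candidates A l) \<and> inj_on z (set (candidates A l))"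
    using assms(1) z(2)
  proof (induction l)
    case (Cons x l)
    have IH: "distinct (candidates A l)" "inj_on z (set (candidates A l))"
      using Cons.IH Cons.prems by auto
    show ?case
    proof (cases "\<exists>u\<in>set l. dominates A u x")
      case False
      have "z x \<noteq> z u" if "u \<in> set (candidates A l)" for u
      proof
        assume "z x = z u"
        moreover have "u \<in> set l" using that set_candidates by blast
        ultimately have "dominates A u x" using Cons.prems(2) by (simp add: dominates_iff)
        then show False using False \<open>u \<in> set l\<close> by blast
      qed
      moreover have "x \<notin> set (candidates A l)" using Cons.prems(1) set_candidates by fastforce
      ultimately show ?thesis using False IH by auto
    qed (use IH in simp)
  qed simp
  moreover have "z ` set (candidates A l) \<subseteq> Z" using z(1) set_candidates by blast
  ultimately show ?thesis
    using card_inj_on_le[of z "set (candidates A l)" Z] assms(2) by (simp add: distinct_card)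
qed

end

section \<open>The branching algorithm\<close>

definition t_node :: "nat \<Rightarrow> nat" where
  "t_node n = 2 * (n * (20 * n + 40)) + n * (20 * ((n + 1) * n) + 40) + t_cores n + t_high n
    + t_candidates n + 30 * n + 200"

fun t_solve :: "nat \<Rightarrow> nat \<Rightarrow> nat \<Rightarrow> nat" where
  "t_solve n b 0 = t_node n"
| "t_solve n b (Suc r) = t_node n + b * (t_solve n b r + 40) + 40"

text \<open>The summand 40 on the left is the overhead per child, so that the induction hypothesis
  fits the recurrence directly.\<close>

lemma t_solve_le: "t_solve n b r + 40 \<le> (b + 1) ^ r * (t_node n + 80)"
proof (induction r)
  case (Suc r)
  have "b * (t_solve n b r + 40) \<le> b * ((b + 1) ^ r * (t_node n + 80))"
    by (rule mult_le_mono2[OF Suc.IH])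
  moreover have "t_node n + 80 \<le> (b + 1) ^ r * (t_node n + 80)" by simp
  moreover have "(b + 1) ^ Suc r * (t_node n + 80) =
      (b + 1) ^ r * (t_node n + 80) + b * ((b + 1) ^ r * (t_node n + 80))"
    by (simp add: algebra_simps)
  ultimately show ?case by (simp only: t_solve.simps)
qed simp

lemma encode_answer_eq_Null [simp]: "encode_answer ans = Null \<longleftrightarrow> ans = None"
  by (cases ans) auto

context matrix_graph
begin

definition solution :: "nat set \<Rightarrow> nat \<Rightarrow> nat set \<Rightarrow> bool" where
  "solution S k X \<longleftrightarrow> hits_twice {0..<n} X \<and> S \<subseteq> X \<and> X \<subseteq> {0..<n} \<and> card X \<le> k"

definition correct :: "nat set \<Rightarrow> nat \<Rightarrow> nat list option \<Rightarrow> bool" where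
  "correct S k ans \<longleftrightarrow> (case ans of Some xs \<Rightarrow> solution S k (set xs) | None \<Rightarrow> \<nexists>X. solution S k X)"

text \<open>Solutions for \<open>insert v S\<close> are solutions for \<open>S\<close>. Conversely,
  the first assumption turns failure of all branches into failure for \<open>S\<close>.\<close>

lemma correct_branch:
  assumes "\<And>X. solution S k X \<Longrightarrow> \<exists>v\<in>L. \<exists>X'. solution (insert v S) k X'"
    and "case ans of None \<Rightarrow> \<forall>v\<in>L. correct (insert v S) k None
      | Some xs \<Rightarrow> \<exists>v\<in>L. correct (insert v S) k (Some xs)"
  shows "correct S k ans"
  using assms by (fastforce simp: correct_def solution_def split: option.splits)

lemma set_cores:
  "v \<in> set (cores U S) \<longleftrightarrow>
    (\<exists>W. core W \<and> v \<in> W \<and> (W \<subseteq> set U \<or> (\<exists>s\<in>set S. W \<subseteq> insert s (set U))))"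
  by (induction S) (auto simp: set_core_of)

abbreviation (input) free :: "nat list \<Rightarrow> nat list" where
  "free S \<equiv> filter (\<lambda>x. x \<notin> set S) [0..<n]"

abbreviation (input) kernel :: "nat list \<Rightarrow> nat list" where
  "kernel S \<equiv> filter (\<lambda>x. x \<notin> set (filter (\<lambda>x. x \<notin> set (cores (free S) S)) (free S))) (free S)"

lemma extension_node: "small S \<Longrightarrow> extension_node a {0..<n} (set S)"
  by unfold_locales (auto simp: small_def)

text \<open>A set with at most one vertex in \<open>S\<close> consists of free vertices and at most
  one vertex of \<open>S\<close>, and the cores of this form are the ones that \<open>cores\<close>
  collects.\<close>

lemma set_kernel:
  assumes "small S"
  shows "set (kernel S) = extension_node.K a {0..<n} (set S)"
proof -
  interpret N: extension_node a "{0..<n}" "set S" using assms by (rule extension_node)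
  have "W \<subseteq> {0..<n} \<and> card (W \<inter> set S) \<le> 1 \<longleftrightarrow>
      W \<subseteq> {0..<n} - set S \<or> (\<exists>s\<in>set S. W \<subseteq> insert s ({0..<n} - set S))" for W
  proof
    assume W: "W \<subseteq> {0..<n} \<and> card (W \<inter> set S) \<le> 1"
    then consider "W \<inter> set S = {}" | s where "W \<inter> set S = {s}"
      by (metis List.finite_set One_nat_def card_0_eq card_1_singletonE finite_Int le_SucE le_zero_eq)
    then show "W \<subseteq> {0..<n} - set S \<or> (\<exists>s\<in>set S. W \<subseteq> insert s ({0..<n} - set S))"
      using W by cases (blast, blast)
  next
    assume "W \<subseteq> {0..<n} - set S \<or> (\<exists>s\<in>set S. W \<subseteq> insert s ({0..<n} - set S))"
    then obtain s where "W \<inter> set S \<subseteq> {s}" "W \<subseteq> {0..<n}" using assms by (auto simp: small_def)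
    then show "W \<subseteq> {0..<n} \<and> card (W \<inter> set S) \<le> 1"
      using card_mono[of "{s}" "W \<inter> set S"] by simp
  qed
  moreover have "set (free S) = {0..<n} - set S" by auto
  ultimately have "v \<in> set (cores (free S) S) \<longleftrightarrow>
      (\<exists>W. W \<subseteq> {0..<n} \<and> core W \<and> card (W \<inter> set S) \<le> 1 \<and> v \<in> W)" for v
    unfolding set_cores by (smt (verit, best))
  then have "v \<in> set (kernel S) \<longleftrightarrow> v \<in> N.K" for v
    unfolding N.K_def by auto
  then show ?thesis by blast
qed

text \<open>\<open>R v ans\<close> stands for whatever the recursive call on \<open>v # S\<close>
  guarantees, so the loop over the candidates is settled before the mutual recursion with
  \<open>solve_body\<close>.\<close>

lemma try_computes:
  assumes "\<And>v. v \<in> set L \<Longrightarrow> \<exists>ans. computes prog 15 [matrix, encode_nats U, encode_nats (v # S),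
      Num (int r), Num (int k), Num (int b)] (encode_answer ans) T \<and> R v ans"
  shows "\<exists>ans. computes prog 16 [matrix, encode_nats U, encode_nats S, Num (int (Suc r)),
      Num (int k), Num (int b), encode_nats L] (encode_answer ans) (length L * (T + 40) + 10) \<and>
    (case ans of None \<Rightarrow> \<forall>v\<in>set L. R v None | Some xs \<Rightarrow> \<exists>v\<in>set L. R v (Some xs))"
  using assms
proof (induction L)
  case Nil
  show ?case
    by (intro exI[of _ None] conjI computesI[where e = try_body]) (auto simp: prog_nth try_body_def)
next
  case (Cons v L)
  obtain ans where ans: "computes prog 15 [matrix, encode_nats U, encode_nats (v # S),
      Num (int r), Num (int k), Num (int b)] (encode_answer ans) T" "R v ans"
    using Cons.prems[of v] by auto
  obtain ans' where ans': "computes prog 16 [matrix, encode_nats U, encode_nats S, Num (int (Suc r)),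
      Num (int k), Num (int b), encode_nats L] (encode_answer ans') (length L * (T + 40) + 10)"
    "case ans' of None \<Rightarrow> \<forall>v\<in>set L. R v None | Some xs \<Rightarrow> \<exists>v\<in>set L. R v (Some xs)"
    using Cons by fastforce
  show ?case
  proof (cases ans)
    case None
    have "computes prog 16 [matrix, encode_nats U, encode_nats S, Num (int (Suc r)),
      Num (int k), Num (int b), encode_nats (v # L)] (encode_answer ans') (length (v # L) * (T + 40) + 10)"
      using computesD[OF ans(1)] computesD[OF ans'(1)] None
      by (intro computesI[where e = try_body]) (auto simp: prog_nth try_body_def)
    then show ?thesis
      using ans(2) ans'(2) None by (intro exI[of _ ans']) (auto split: option.splits)
  next
    case (Some xs)
    have "computes prog 16 [matrix, encode_nats U, encode_nats S, Num (int (Suc r)),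
      Num (int k), Num (int b), encode_nats (v # L)] (encode_answer ans) (length (v # L) * (T + 40) + 10)"
      using computesD[OF ans(1)] Some
      by (intro computesI[where e = try_body]) (auto simp: prog_nth try_body_def)
    then show ?thesis
      using ans(2) Some by (intro exI[of _ ans]) auto
  qed
qed

lemma t_node_le: "t_node n \<le> t_solve n b r"
  by (cases r) auto

text \<open>Induction on the remaining budget \<open>r\<close>. By the invariant
  \<open>length S + r = k\<close>, the set of \<open>S\<close> is the only possible solution once
  the budget is zero.\<close>

lemma solve_computes:
  assumes "small S" "length S + r = k" "b = 11 * k ^ 3"
  shows "\<exists>ans. computes prog 15 [matrix, encode_nats [0..<n], encode_nats S, Num (int r),
      Num (int k), Num (int b)] (encode_answer ans) (t_solve n b r) \<and> correct (set S) k ans"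
  using assms(1,2)
proof (induction r arbitrary: S rule: less_induct)
  case (less r)
  note S = \<open>small S\<close>
  interpret N: extension_node a "{0..<n}" "set S" using S by (rule extension_node)
  define W where "W = [0..<n]"
  define U where "U = free S"
  define c where "c = cores U S"
  define D where "D = filter (\<lambda>x. x \<notin> set c) U"
  define Q where "Q = filter (\<lambda>x. x \<notin> set D) U"
  define B where "B = Q @ S"
  define H where "H = first_high B k Q"
  define C where "C = candidates B Q"
  have setQ: "set Q = N.K"
    unfolding Q_def D_def c_def U_def by (rule set_kernel[OF S])
  have setB: "set B = N.A" by (simp add: B_def setQ N.A_def)
  have U: "small U" "set U \<inter> set S = {}" by (auto simp: U_def small_def)
  have Q: "small Q" "small D" using U(1) by (simp_all add: Q_def D_def small_filter)
  have B: "small B"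
    using S Q(1) U(2) by (auto simp: B_def small_def Q_def)
  have C: "small C" "set C \<subseteq> N.K"
  proof -
    have "distinct (candidates B l)" if "distinct l" for l
      using that by (induction l) (auto dest: set_candidates[THEN subsetD])
    then show "small C"
      using Q(1) set_candidates[of B Q] by (auto simp: C_def small_def)
    show "set C \<subseteq> N.K" using set_candidates[of B Q] setQ by (simp add: C_def)
  qed
  note len = small_length[OF S] small_length[OF U(1)] small_length[OF Q(1)] small_length[OF Q(2)]
    small_length[OF C(1)]
  have lenc: "length c \<le> (n + 1) * n"
  proof -
    have "length c \<le> (length S + 1) * n" unfolding c_def by (rule length_cores[OF U(1) S U(2)])
    also have "\<dots> \<le> (n + 1) * n" using len(1) by (intro mult_le_mono1) simp
    finally show ?thesis .
  qed
  have c1: "computes prog 6 [encode_nats W, encode_nats S] (encode_nats U) (n * (20 * n + 40) + 10)"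
    unfolding W_def U_def using len(1)
    by (intro computes_mono[OF diff_computes]) (simp add: mult_le_mono)
  have c2: "computes prog 8 [matrix, encode_nats U, encode_nats S] (encode_nats c) (t_cores n)"
    unfolding c_def by (rule cores_computes[OF U(1) S U(2)])
  have c3: "computes prog 6 [encode_nats U, encode_nats c] (encode_nats D)
      (n * (20 * ((n + 1) * n) + 40) + 10)"
    unfolding D_def using len(2) lenc
    by (intro computes_mono[OF diff_computes] add_mono mult_le_mono) simp_all
  have c4: "computes prog 6 [encode_nats U, encode_nats D] (encode_nats Q) (n * (20 * n + 40) + 10)"
    unfolding Q_def using len(2,4)
    by (intro computes_mono[OF diff_computes] add_mono mult_le_mono) simp_all
  have c5: "computes prog 7 [encode_nats Q, encode_nats S] (encode_nats B) (20 * n + 10)"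
    unfolding B_def using len(3) by (intro computes_mono[OF append_computes]) simp
  have c6: "computes prog 9 [matrix, encode_nats B, encode_nats Q, Num (int k)] (encode_nats H)
      (t_high n)"
    unfolding H_def by (rule high_computes[OF B Q(1)])
  have c7: "computes prog 11 [matrix, encode_nats B, encode_nats Q] (encode_nats C) (t_candidates n)"
    unfolding C_def by (rule candidates_computes[OF B Q(1)])
  have c8: "computes prog 12 [encode_nats C] (Num (int (length C))) (10 * n + 10)"
    using len(5) by (intro computes_mono[OF length_computes]) simp
  note calls = computesD[OF c1] computesD[OF c2] computesD[OF c3] computesD[OF c4] computesD[OF c5]
    computesD[OF c6] computesD[OF c7] computesD[OF c8]
  let ?args = "[matrix, encode_nats W, encode_nats S, Num (int r), Num (int k), Num (int b)]"
  have card_S: "card (set S) = length S" using S by (simp add: small_def distinct_card)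
  have S_sub: "set S \<subseteq> {0..<n}" using S by (simp add: small_def)
  have solved: "solved_node a {0..<n} (set S) X k" if "solution (set S) k X" for X
    using that by unfold_locales (auto simp: solution_def)
  \<comment> \<open>The cases are the exits of \<open>solve_body\<close>: no core left to hit,
    budget spent, too many candidates, and branching.\<close>
  consider (finished) "Q = []" | (stop) "Q \<noteq> []" "r = 0"
    | (many) r' where "Q \<noteq> []" "r = Suc r'" "H = []" "b < length C"
    | (branch) r' L where "Q \<noteq> []" "r = Suc r'" "L = (if H = [] then C else H)"
        "H = [] \<Longrightarrow> length C \<le> b"
    by (metis not_less not0_implies_Suc)
  then have "\<exists>ans. computes prog 15 ?args (encode_answer ans) (t_solve n b r) \<and> correct (set S) k ans"
  proof cases
    case finished
    have "computes prog 15 ?args (encode_answer (Some S)) (t_node n)"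
      using calls finished
      by (intro computesI[where e = solve_body]) (auto simp: prog_nth solve_body_def t_node_def)
    moreover have "correct (set S) k (Some S)"
      using finished setQ N.hits_twice_iff_K_empty S_sub less.prems(2) card_S
      by (simp add: correct_def solution_def)
    ultimately show ?thesis using computes_mono[OF _ t_node_le] by blast
  next
    case stop
    have "computes prog 15 ?args (encode_answer None) (t_node n)"
      using calls stop
      by (intro computesI[where e = solve_body]) (auto simp: prog_nth solve_body_def t_node_def)
    moreover have "\<not> solution (set S) k X" for X
    proof
      assume X: "solution (set S) k X"
      then have "finite X" using finite_subset by (auto simp: solution_def)
      then have "set S = X"
        using X card_S less.prems(2) stop(2) by (intro card_seteq) (auto simp: solution_def)
      then show False
        using X N.hits_twice_iff_K_empty setQ stop(1) by (simp add: solution_def)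
    qed
    ultimately show ?thesis using computes_mono[OF _ t_node_le] by (fastforce simp: correct_def)
  next
    case (many r')
    have "computes prog 15 ?args (encode_answer None) (t_node n)"
      using calls many
      by (intro computesI[where e = solve_body]) (auto simp: prog_nth solve_body_def t_node_def)
    moreover have "\<not> solution (set S) k X" for X
    proof
      assume "solution (set S) k X"
      then interpret M: solved_node a "{0..<n}" "set S" X k by (rule solved)
      \<comment> \<open>No vertex of \<open>K\<close> exceeds degree \<open>k\<close>, so a solution
        would yield a transversal of at most \<open>b\<close> vertices and thereby at most
        \<open>b\<close> candidates.\<close>
      have "\<forall>v\<in>N.K. deg v N.A \<le> k"
        using many(3) setQ setB first_high_cases[of B k Q] unfolding H_def by (metis list.distinct(1))
      then obtain Z where Z: "finite Z" "card Z \<le> 11 * k ^ 3"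
        "\<forall>v\<in>N.K. \<exists>z\<in>Z. \<forall>W. core W \<longrightarrow> W \<subseteq> N.A \<longrightarrow> (v \<in> W \<longleftrightarrow> z \<in> W)"
        using M.transversal by blast
      have "length C \<le> card Z"
        unfolding C_def using Q(1) Z(1,3)
        by (intro length_candidates_le) (simp_all add: small_def setQ setB)
      then show False using Z(2) many(4) assms(3) by simp
    qed
    ultimately show ?thesis using computes_mono[OF _ t_node_le] by (fastforce simp: correct_def)
  next
    case (branch r' L)
    have high: "v \<in> N.K" "k < deg v N.A" if "H = [v]" for v
      using that setQ setB first_high_cases[of B k Q] unfolding H_def by fastforce+
    have single: "\<exists>v. H = [v]" if "H \<noteq> []"
      using that first_high_cases[of B k Q] unfolding H_def by metis
    have L: "small L" "set L \<subseteq> N.K" "length L \<le> b"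
    proof -
      have "set H \<subseteq> N.K" "small H" "length H \<le> b" if "H \<noteq> []"
      proof -
        obtain v where v: "H = [v]" using single \<open>H \<noteq> []\<close> by blast
        \<comment> \<open>A forced vertex is a branch of its own; the remaining budget makes
          \<open>k\<close> positive, so \<open>b\<close> is large enough to count it.\<close>
        have "1 \<le> b" using branch(2) less.prems(2) assms(3) by auto
        then show "set H \<subseteq> N.K" "small H" "length H \<le> b"
          using v high(1)[OF v] N.K_sub by (auto simp: small_def)
      qed
      then show "small L" "set L \<subseteq> N.K" "length L \<le> b"
        using C branch(3,4) by (auto split: if_splits)
    qed
    have cover: "\<exists>v\<in>set L. \<exists>X'. solution (insert v (set S)) k X'"
      if X: "solution (set S) k X" for X
    proof (cases "H = []")
      case True
      have "\<exists>u\<in>set C. \<forall>W. core W \<longrightarrow> W \<subseteq> N.A \<longrightarrow> y \<in> W \<longrightarrow> u \<in> W" if "y \<in> N.K" for y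
        using candidates_dominate[of y Q B] that setQ setB unfolding C_def dominates_iff by metis
      moreover have "N.K \<noteq> {}" using branch(1) setQ by auto
      ultimately show ?thesis
        using N.extension_by_candidate[of X k "set C"] X C(2) True branch(3)
        by (simp add: solution_def)
    next
      case False
      then obtain v where v: "H = [v]" using single by blast
      interpret M: solved_node a "{0..<n}" "set S" X k using X by (rule solved)
      \<comment> \<open>Vertices of \<open>K\<close> outside a solution have degree at most
        \<open>k\<close>, so \<open>v\<close> belongs to every solution and one branch
        suffices.\<close>
      have "v \<in> X" using M.deg_le[of v] high[OF v] by (auto simp: M.F_def)
      then show ?thesis using X v False branch(3) by (auto simp: solution_def)
    qed
    have "\<exists>ans. computes prog 15 [matrix, encode_nats W, encode_nats (v # S), Num (int r'),
        Num (int k), Num (int b)] (encode_answer ans) (t_solve n b r') \<and> correct (insert v (set S)) k ans"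
      if "v \<in> set L" for v
    proof -
      have "small (v # S)" using that L(2) N.K_sub N.K_S S by (auto simp: small_def)
      then show ?thesis
        using less.IH[of r' "v # S"] branch(2) less.prems(2) by (simp add: W_def)
    qed
    from try_computes[OF this] obtain ans where ans:
      "computes prog 16 [matrix, encode_nats W, encode_nats S, Num (int (Suc r')), Num (int k),
        Num (int b), encode_nats L] (encode_answer ans) (length L * (t_solve n b r' + 40) + 10)"
      "case ans of None \<Rightarrow> \<forall>v\<in>set L. correct (insert v (set S)) k None
        | Some xs \<Rightarrow> \<exists>v\<in>set L. correct (insert v (set S)) k (Some xs)"
      by blast
    have le: "length L * (t_solve n b r' + 40) \<le> b * (t_solve n b r' + 40)"
      using L(3) by (rule mult_le_mono1)
    have "computes prog 15 ?args (encode_answer ans)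
        (t_node n + length L * (t_solve n b r' + 40) + 40)"
      using calls computesD[OF ans(1)] branch
      by (intro computesI[where e = solve_body])
        (auto simp: prog_nth solve_body_def t_node_def split: if_splits)
    then have "computes prog 15 ?args (encode_answer ans) (t_solve n b r)"
      by (rule computes_mono) (use le branch(2) in simp)
    moreover have "correct (set S) k ans" using correct_branch[OF cover ans(2)] .
    ultimately show ?thesis by blast
  qed
  then show ?case by (simp add: W_def)
qed

text \<open>Negative \<open>k\<close> is singled out because \<open>nat k\<close> turns it into
  zero, for which the empty set may be a solution.\<close>

lemma main_computes:
  assumes "small S"
  shows "\<exists>ans b. computes prog 0 [matrix, encode_nats S, Num k] (encode_answer ans) b \<and>
    b \<le> (nat k + 2) ^ (7 * nat k) * (t_node n + 30 * n + 400) \<and>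
    (if k < 0 then ans = None else correct (set S) (nat k) ans)"
proof (cases "k < int (length S)")
  case True
  have "computes prog 0 [matrix, encode_nats S, Num k] (encode_answer None) (10 * n + 50)"
    using computesD[OF length_computes[of S]] small_length[OF assms] True
    by (intro computesI[where e = main_body]) (auto simp: prog_nth main_body_def)
  moreover have "10 * n + 50 \<le> 1 * (t_node n + 30 * n + 400)" by simp
  then have "10 * n + 50 \<le> (nat k + 2) ^ (7 * nat k) * (t_node n + 30 * n + 400)"
    by (rule order_trans) (intro mult_le_mono1, simp)
  moreover have "\<not> solution (set S) (nat k) X" if "0 \<le> k" for X
  proof
    assume X: "solution (set S) (nat k) X"
    then have "card (set S) \<le> card X"
      by (intro card_mono) (auto simp: solution_def intro: finite_subset)
    also have "\<dots> \<le> nat k" using X by (simp add: solution_def)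
    finally show False using that True assms by (simp add: small_def distinct_card)
  qed
  ultimately show ?thesis
    by (intro exI[of _ None] exI[of _ "10 * n + 50"]) (auto simp: correct_def)
next
  case False
  define m where "m = nat k"
  have k: "k = int m" using False by (simp add: m_def)
  define r where "r = m - length S"
  have r: "length S + r = m" "k - int (length S) = int r" using False k by (auto simp: r_def)
  define b where "b = 11 * m ^ 3"
  have b: "m * (m * (m * 11)) = b" by (simp add: b_def power3_eq_cube)
  obtain ans where ans: "computes prog 15 [matrix, encode_nats [0..<n], encode_nats S, Num (int r),
      Num (int m), Num (int b)] (encode_answer ans) (t_solve n b r)" "correct (set S) m ans"
    using solve_computes[OF assms r(1) b_def] by blast
  define W where "W = [0..<n]"
  have v: "computes prog 14 [matrix, Num 0] (encode_nats W) (20 * n + 10)"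
    using vertices_computes[of "map row [0..<n]" 0] by (simp add: matrix_def W_def)
  have t1: "computes prog 13 [Num (int m), Num 11] (Num (int (m * 11))) (10 * m + 10)"
    using times_computes[of m 11] by simp
  have t2: "computes prog 13 [Num (int m), Num (int (m * 11))] (Num (int (m * (m * 11)))) (10 * m + 10)"
    by (rule times_computes)
  have t3: "computes prog 13 [Num (int m), Num (int (m * (m * 11)))] (Num (int b)) (10 * m + 10)"
    using times_computes[of m "m * (m * 11)"] unfolding b .
  let ?t = "t_solve n b r + 30 * n + 30 * m + 120"
  have "computes prog 0 [matrix, encode_nats S, Num k] (encode_answer ans) ?t"
    using computesD[OF length_computes[of S]] small_length[OF assms] computesD[OF v]
      computesD[OF t1] computesD[OF t2] computesD[OF t3] computesD[OF ans(1)[folded W_def]] r(2)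
    by (intro computesI[where e = main_body])
      (auto simp: prog_nth main_body_def k simp del: of_nat_mult)
  moreover have "?t \<le> (m + 2) ^ (7 * m) * (t_node n + 30 * n + 400)"
  proof -
    have "m ^ 3 \<le> (m + 2) ^ 3" "1 \<le> (m + 2) ^ 3"
      by (intro power_mono one_le_power; simp)+
    \<comment> \<open>Since \<open>12 \<le> (m + 2) ^ 4\<close>, the branching degree plus one is at
      most \<open>(m + 2) ^ 7\<close>, and the depth \<open>r\<close> is at most \<open>m\<close>.
      This is the origin of the exponent \<open>7 * m\<close>.\<close>
    then have "b + 1 \<le> 12 * (m + 2) ^ 3" unfolding b_def by linarith
    also have "\<dots> \<le> (m + 2) ^ 4 * (m + 2) ^ 3"
      using power_mono[of 2 "m + 2" 4] by (intro mult_le_mono1) simp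
    finally have "b + 1 \<le> (m + 2) ^ 7" by (simp flip: power_add)
    then have "(b + 1) ^ r \<le> ((m + 2) ^ 7) ^ r" by (rule power_mono) simp
    also have "\<dots> \<le> (m + 2) ^ (7 * m)"
      unfolding power_mult[symmetric] using r(1) by (intro power_increasing) auto
    finally have "(b + 1) ^ r * (t_node n + 80) \<le> (m + 2) ^ (7 * m) * (t_node n + 80)"
      by (rule mult_le_mono1)
    then have "t_solve n b r + 40 \<le> (m + 2) ^ (7 * m) * (t_node n + 80)"
      using t_solve_le[of n b r] by linarith
    moreover have "m < (m + 2) ^ (7 * m)"
    proof -
      have "m < 2 ^ m" by (rule less_exp)
      also have "(2::nat) ^ m \<le> (m + 2) ^ m" by (intro power_mono) auto
      also have "\<dots> \<le> (m + 2) ^ (7 * m)" by (intro power_increasing) auto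
      finally show ?thesis .
    qed
    moreover have "30 * n + 120 \<le> (m + 2) ^ (7 * m) * (30 * n + 120)" by simp
    ultimately have "?t \<le> (m + 2) ^ (7 * m) * (t_node n + 80) +
        (m + 2) ^ (7 * m) * (30 * n + 120) + 30 * (m + 2) ^ (7 * m)"
      by linarith
    also have "\<dots> \<le> (m + 2) ^ (7 * m) * (t_node n + 30 * n + 400)"
      by (simp add: distrib_left)
    finally show ?thesis .
  qed
  ultimately show ?thesis
    using ans(2) by (intro exI[of _ ans] exI[of _ ?t]) (simp add: k)
qed

end

section \<open>Polynomial bounds in the number of vertices\<close>

definition poly_bounded :: "(nat \<Rightarrow> nat) \<Rightarrow> bool" where
  "poly_bounded f \<longleftrightarrow> (\<exists>c. \<forall>n. f n \<le> c * (n + 1) ^ c)"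

lemma poly_bounded_const: "poly_bounded (\<lambda>n. m)"
proof -
  have "m \<le> m * (n + 1) ^ m" for n by simp
  then show ?thesis unfolding poly_bounded_def by blast
qed

lemma poly_bounded_id: "poly_bounded (\<lambda>n. n)"
  unfolding poly_bounded_def by (intro exI[of _ 1]) simp

lemma poly_bounded_add:
  assumes "poly_bounded f" "poly_bounded g"
  shows "poly_bounded (\<lambda>n. f n + g n)"
proof -
  obtain c d where c: "\<And>n. f n \<le> c * (n + 1) ^ c" and d: "\<And>n. g n \<le> d * (n + 1) ^ d"
    using assms by (auto simp: poly_bounded_def)
  have "f n + g n \<le> (c + d) * (n + 1) ^ (c + d)" for n
  proof -
    have "c * (n + 1) ^ c \<le> c * (n + 1) ^ (c + d)" "d * (n + 1) ^ d \<le> d * (n + 1) ^ (c + d)"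
      by (intro mult_le_mono2 power_increasing; simp)+
    then show ?thesis using c[of n] d[of n] unfolding distrib_right by linarith
  qed
  then show ?thesis unfolding poly_bounded_def by blast
qed

lemma poly_bounded_mult:
  assumes "poly_bounded f" "poly_bounded g"
  shows "poly_bounded (\<lambda>n. f n * g n)"
proof -
  obtain c d where c: "\<And>n. f n \<le> c * (n + 1) ^ c" and d: "\<And>n. g n \<le> d * (n + 1) ^ d"
    using assms by (auto simp: poly_bounded_def)
  \<comment> \<open>\<open>?e\<close> is at least the product of the factors and at least the sum of
    the exponents.\<close>
  let ?e = "c * d + (c + d)"
  have "f n * g n \<le> ?e * (n + 1) ^ ?e" for n
  proof -
    have "f n * g n \<le> (c * (n + 1) ^ c) * (d * (n + 1) ^ d)" by (rule mult_le_mono[OF c d])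
    also have "\<dots> = (c * d) * (n + 1) ^ (c + d)" by (simp add: power_add)
    also have "\<dots> \<le> ?e * (n + 1) ^ ?e" by (intro mult_le_mono power_increasing) auto
    finally show ?thesis .
  qed
  then show ?thesis unfolding poly_bounded_def by blast
qed

lemma poly_bounded_t_node: "poly_bounded (\<lambda>n. t_node n + 30 * n + 400)"
  unfolding t_node_def t_candidates_def t_dominated_def t_high_def t_cores_def t_core_def
    t_prune_def t_degree_def
  by (intro poly_bounded_add poly_bounded_mult poly_bounded_const poly_bounded_id)

theorem theorem5:
  shows "\<exists>(P :: program) (c :: nat).
    \<forall>(G :: nat mgraph) (n :: nat) (S :: nat set) (k :: int).
      multigraph G \<and> verts G = {0..<n} \<and> S \<subseteq> verts G \<longrightarrow>
      (\<exists>answer t.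
         runs P (encode_instance G S k) (encode_answer answer) t \<and>
         t \<le> fpt_time_bound c k n \<and>
         (case answer of
            Some xs \<Rightarrow> ft_fvs_ext_solution G S k (set xs)
          | None \<Rightarrow> \<not> (\<exists>X. ft_fvs_ext_solution G S k X)))"
proof -
  obtain d where d: "\<And>n. t_node n + 30 * n + 400 \<le> d * (n + 1) ^ d"
    using poly_bounded_t_node by (auto simp: poly_bounded_def)
  have "\<exists>answer t.
         runs prog (encode_instance G S k) (encode_answer answer) t \<and>
         t \<le> fpt_time_bound (d + 7) k n \<and>
         (case answer of
            Some xs \<Rightarrow> ft_fvs_ext_solution G S k (set xs)
          | None \<Rightarrow> \<not> (\<exists>X. ft_fvs_ext_solution G S k X))"
    if G: "multigraph G" "verts G = {0..<n}" "S \<subseteq> verts G" for G n S k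
  proof -
    interpret C: mgraph_cores G by unfold_locales (rule G(1))
    interpret M: matrix_graph "adj G" n ..
    define xs where "xs = sorted_list_of_set S"
    have xs: "set xs = S" "M.small xs"
      using G(2,3) finite_subset[of S "{0..<n}"] by (auto simp: xs_def M.small_def)
    have adj_fun: "adj G u = (\<lambda>v. count (edges G) {u, v})" for u
      by (simp add: adj_def fun_eq_iff)
    have inst: "encode_instance G S k = [M.matrix, encode_nats xs, Num k]"
      by (simp add: encode_instance_def encode_graph_def M.matrix_def M.row_def[abs_def] adj_fun xs_def
          G(2) Let_def)
    obtain ans b where ans: "computes prog 0 [M.matrix, encode_nats xs, Num k] (encode_answer ans) b"
      "b \<le> (nat k + 2) ^ (7 * nat k) * (t_node n + 30 * n + 400)"
      "if k < 0 then ans = None else M.correct S (nat k) ans"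
      using M.main_computes[OF xs(2), of k] unfolding xs(1) by blast
    obtain t where t: "t \<le> b" "runs prog (encode_instance G S k) (encode_answer ans) t"
      using runs_if_computes[OF ans(1)] unfolding inst by blast
    have sol: "ft_fvs_ext_solution G S k X \<longleftrightarrow> 0 \<le> k \<and> M.solution S (nat k) X" for X
      unfolding ft_fvs_ext_solution_def M.solution_def C.one_fvs_iff_hits_twice G(2)
      by (auto simp: le_nat_iff)
    \<comment> \<open>\<open>fpt_time_bound\<close> has a single constant for the factor and both
      exponents, and \<open>d + 7\<close> is at least as large as \<open>d\<close> and
      \<open>7\<close>.\<close>
    have "b \<le> (nat k + 2) ^ (7 * nat k) * (d * (n + 1) ^ d)"
      using ans(2) mult_le_mono2[OF d[of n]] by (rule order_trans)
    also have "\<dots> \<le> (nat k + 2) ^ ((d + 7) * nat k) * ((d + 7) * (n + 1) ^ (d + 7))"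
      by (intro mult_le_mono power_increasing) auto
    also have "\<dots> = fpt_time_bound (d + 7) k n" by (simp add: fpt_time_bound_def)
    finally have "t \<le> fpt_time_bound (d + 7) k n" using t(1) by linarith
    moreover have "case ans of
            Some xs \<Rightarrow> ft_fvs_ext_solution G S k (set xs)
          | None \<Rightarrow> \<not> (\<exists>X. ft_fvs_ext_solution G S k X)"
      using ans(3) unfolding sol M.correct_def by (auto split: option.splits if_splits)
    ultimately show ?thesis using t(2) by blast
  qed
  then show ?thesis by blast
qed

end
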